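(* Let $B$ be a commutative, unital $C^*$-algebra and suppose $T$ is a $B$-valued circular element in a $B$-valued $C^*$-noncommutative probability space $(A,E)$ with $E$ faithful. Then for every $n\in\mathbb{N}$, all $\epsilon(1),\ldots,\epsilon(n)\in\{1,*\}$ and all $b_1,\ldots,b_n\in B$, we have $$\|T^{\epsilon(1)}b_1T^{\epsilon(2)}b_2\cdots T^{\epsilon(n)}b_n\|\le\left(\prod_{j=1}^n\|b_j\|\right)\|T^{\epsilon(1)}T^{\epsilon(2)}\cdots T^{\epsilon(n)}\|.$$ In particular, if $T$ is quasinilpotent and $b_1,b_2\in B$, then $b_1Tb_2$ is quasinilpotent.
   Context: A $B$-valued $C^*$-noncommutative probability space is a pair $(A,E)$ where $A$ is a unital $C^*$-algebra containing a unital copy of $B$ and $E:A\to B$ is a conditional expectation. $E$ is faithful if $E(x^*x)=0$ implies $x=0$. For $B$ commutative, $T\in A$ is a $B$-valued circular element if $E(T)=0$ and the only nonvanishing $B$-valued (noncrossing) cumulants of the pair $(T,T^* )$ are the second-order ones given by the completely positive maps $\alpha_{1,2}(b)=E(TbT^* )$ and $\alpha_{2,1}(b)=E(T^*bT)$ on $B$. Equivalently (moment-cumulant formula): for all $n\ge1$, $\epsilon(1),\ldots,\epsilon(n)\in\{1,*\}$ and $b_1,\ldots,b_n\in B$, $$E(T^{\epsilon(1)}b_1\cdots T^{\epsilon(n)}b_n)=\sum_{\substack{2\le j\le n\\ \epsilon(j)\ne\epsilon(1)}}\alpha\big(b_1E(T^{\epsilon(2)}b_2\cdots T^{\epsilon(j-1)}b_{j-1})\big)\,b_j\,E(T^{\epsilon(j+1)}b_{j+1}\cdots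 T^{\epsilon(n)}b_n),$$ where $\alpha=\alpha_{1,2}$ if $\epsilon(1)=1$, $\alpha=\alpha_{2,1}$ if $\epsilon(1)=*$, and $E$ of an empty product is $1$. *)

theory Defs
  imports "HOL-Analysis.Analysis"
begin

section \<open>Unital C*-algebras\<close>

text \<open>The class inherits \<^prop>\<open>norm 1 = 1\<close>, so the zero algebra is excluded.\<close>

class cstar_algebra = banach + real_normed_algebra_1 +
  fixes scaleC :: "complex \<Rightarrow> 'a \<Rightarrow> 'a"
    and star :: "'a \<Rightarrow> 'a"
  assumes scaleR_scaleC: "scaleR r x = scaleC (complex_of_real r) x"
    and scaleC_add_right: "scaleC c (x + y) = scaleC c x + scaleC c y"
    and scaleC_add_left: "scaleC (c + d) x = scaleC c x + scaleC d x"
    and scaleC_scaleC: "scaleC c (scaleC d x) = scaleC (c * d) x"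
    and scaleC_one: "scaleC 1 x = x"
    and mult_scaleC_left: "scaleC c x * y = scaleC c (x * y)"
    and mult_scaleC_right: "x * scaleC c y = scaleC c (x * y)"
    and norm_scaleC: "norm (scaleC c x) = cmod c * norm x"
    and star_star: "star (star x) = x"
    and star_add: "star (x + y) = star x + star y"
    and star_scaleC: "star (scaleC c x) = scaleC (cnj c) (star x)"
    and star_mult: "star (x * y) = star y * star x"
    and cstar_identity: "norm (star x * x) = (norm x)\<^sup>2"

class comm_cstar_algebra = cstar_algebra + comm_ring_1

instantiation complex :: comm_cstar_algebra
begin

definition scaleC_complex :: "complex \<Rightarrow> complex \<Rightarrow> complex"
  where "scaleC_complex = (*)"

definition star_complex :: "complex \<Rightarrow> complex"
  where "star_complex = cnj"

instance
  by standard
    (simp_all add: scaleC_complex_def star_complex_def scaleR_conv_of_real algebra_simps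
      norm_mult power2_eq_square)

end

definition positive_elem :: "'a::cstar_algebra \<Rightarrow> bool"
  where "positive_elem x \<longleftrightarrow> (\<exists>y. x = star y * y)"

definition invertible_elem :: "'a::cstar_algebra \<Rightarrow> bool"
  where "invertible_elem x \<longleftrightarrow> (\<exists>y. x * y = 1 \<and> y * x = 1)"

definition spectrum :: "'a::cstar_algebra \<Rightarrow> complex set"
  where "spectrum x = {c. \<not> invertible_elem (scaleC c 1 - x)}"

definition quasinilpotent :: "'a::cstar_algebra \<Rightarrow> bool"
  where "quasinilpotent x \<longleftrightarrow> spectrum x = {0}"


section \<open>\<open>B\<close>-valued C*-noncommutative probability spaces\<close>

text \<open>
  \<open>A\<close> and \<open>B\<close> are the types \<^typ>\<open>'a\<close> and \<^typ>\<open>'b\<close>; the unital copy of \<open>B\<close> inside \<open>A\<close> is the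
  image of the isometric unital *-homomorphism \<open>emb\<close>.  (For *-homomorphisms between C*-algebras,
  being isometric is the same as being injective.)  A conditional expectation is a positive linear
  \<open>B\<close>-bimodule map that restricts to the identity on \<open>B\<close>; contractivity and complete positivity
  are consequences.
\<close>

locale cstar_ncps =
  fixes emb :: "'b::cstar_algebra \<Rightarrow> 'a::cstar_algebra"
    and E :: "'a \<Rightarrow> 'b"
  assumes emb_add: "emb (b + c) = emb b + emb c"
    and emb_scaleC: "emb (scaleC z b) = scaleC z (emb b)"
    and emb_mult: "emb (b * c) = emb b * emb c"
    and emb_one: "emb 1 = 1"
    and emb_star: "emb (star b) = star (emb b)"
    and norm_emb: "norm (emb b) = norm b"
    and E_add: "E (x + y) = E x + E y"
    and E_scaleC: "E (scaleC z x) = scaleC z (E x)"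
    and E_emb: "E (emb b) = b"
    and E_bimodule: "E (emb b * x * emb c) = b * E x * c"
    and E_positive: "positive_elem (E (star x * x))"

definition faithful_expectation :: "('a::cstar_algebra \<Rightarrow> 'b::cstar_algebra) \<Rightarrow> bool"
  where "faithful_expectation E \<longleftrightarrow> (\<forall>x. E (star x * x) = 0 \<longrightarrow> x = 0)"


section \<open>\<open>B\<close>-valued cumulants and circular elements\<close>

text \<open>
  A list \<open>ps\<close> in \<open>first_blocks [a\<^sub>1, \<dots>, a\<^sub>n]\<close> encodes the choice of a block
  \<open>1 = i\<^sub>1 < \<dots> < i\<^sub>k\<close> of positions containing the first one: its \<open>m\<close>-th entry is \<open>a\<close> at position
  \<open>i\<^sub>m\<close> paired with the list of the \<open>a\<close> at the positions strictly between \<open>i\<^sub>m\<close> and \<open>i\<^sub>m\<^sub>+\<^sub>1\<close>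
  (respectively after \<open>i\<^sub>k\<close>, if \<open>m = k\<close>).
\<close>

definition first_blocks :: "'x list \<Rightarrow> ('x \<times> 'x list) list set"
  where "first_blocks xs = {ps. concat (map (\<lambda>(x, g). x # g) ps) = xs}"

text \<open>
  The cumulants \<open>\<kappa>\<^sub>n : A\<^sup>n \<rightarrow> B\<close> are determined by the moment-cumulant formula
  \<open>E (a\<^sub>1 \<cdots> a\<^sub>n) = \<Sum>\<pi>\<in>NC(n). \<kappa>\<^sub>\<pi> (a\<^sub>1, \<dots>, a\<^sub>n)\<close>.  Collecting the noncrossing partitions with a given
  block \<open>V = {1 = i\<^sub>1 < \<dots> < i\<^sub>k}\<close> of the first position, and summing over the arbitrary noncrossing
  partitions of each of the intervals left by \<open>V\<close>, the formula reads
  \<open>E (a\<^sub>1 \<cdots> a\<^sub>n) = \<Sum>V. \<kappa>\<^sub>k (a\<^bsub>i\<^sub>1\<^esub> E(g\<^sub>1), \<dots>, a\<^bsub>i\<^sub>k\<^esub> E(g\<^sub>k))\<close>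
  where \<open>g\<^sub>m\<close> is the product over the \<open>m\<close>-th interval (see \<open>moment_cumulant\<close> below).  Solving
  for the term with \<open>k = n\<close> gives the recursion.
\<close>

function cumulant :: "('b::cstar_algebra \<Rightarrow> 'a::cstar_algebra) \<Rightarrow> ('a \<Rightarrow> 'b) \<Rightarrow> 'a list \<Rightarrow> 'b"
  where "cumulant emb E xs = E (prod_list xs) -
    (\<Sum>ps\<in>{ps \<in> first_blocks xs. length ps < length xs}.
      cumulant emb E (map (\<lambda>(x, g). x * emb (E (prod_list g))) ps))"
  by auto
termination
  by (relation "Wellfounded.measure (\<lambda>(emb, E, xs). length xs)") auto

declare cumulant.simps [simp del]

datatype exponent = Plain | Adjoint

primrec letter :: "'a::cstar_algebra \<Rightarrow> exponent \<Rightarrow> 'a"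
  where
    "letter T Plain = T"
  | "letter T Adjoint = star T"

definition circular ::
    "('b::cstar_algebra \<Rightarrow> 'a::cstar_algebra) \<Rightarrow> ('a \<Rightarrow> 'b) \<Rightarrow> 'a \<Rightarrow> bool"
  where "circular emb E T \<longleftrightarrow>
    E T = 0 \<and>
    (\<forall>b c. cumulant emb E [T * emb b, star T * emb c] = E (T * emb b * star T) * c) \<and>
    (\<forall>b c. cumulant emb E [star T * emb b, T * emb c] = E (star T * emb b * T) * c) \<and>
    (\<forall>n \<epsilon> b. 1 \<le> n \<and> \<not> (n = 2 \<and> \<epsilon> 1 \<noteq> \<epsilon> 2) \<longrightarrow>
      cumulant emb E (map (\<lambda>j. letter T (\<epsilon> j) * emb (b j)) [1..<n+1]) = 0)"


subsection \<open>The moment-cumulant formula\<close>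

lemma first_blocks_Nil [simp]: "first_blocks [] = {[]}"
  by (auto simp: first_blocks_def split: prod.splits) (metis list.exhaust_sel list.set_intros(1) surj_pair)

lemma first_blocks_Cons:
  "first_blocks (x # xs) = (\<Union>k\<le>length xs. Cons (x, take k xs) ` first_blocks (drop k xs))"
proof (intro equalityI subsetI)
  fix ps assume "ps \<in> first_blocks (x # xs)"
  then obtain g qs where "ps = (x, g) # qs" "g @ concat (map (\<lambda>(x, g). x # g) qs) = xs"
    by (cases ps) (auto simp: first_blocks_def)
  then show "ps \<in> (\<Union>k\<le>length xs. Cons (x, take k xs) ` first_blocks (drop k xs))"
    by (auto simp: first_blocks_def intro!: bexI[of _ "length g"])
qed (auto simp: first_blocks_def)

lemma finite_first_blocks [simp]: "finite (first_blocks xs)"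
proof (induction xs rule: length_induct)
  case (1 xs)
  then show ?case by (cases xs) (auto simp: first_blocks_Cons)
qed

lemma length_first_blocks: "ps \<in> first_blocks xs \<Longrightarrow> length ps \<le> length xs"
proof (induction ps arbitrary: xs)
  case (Cons p ps)
  obtain x g where p: "p = (x, g)" by (cases p)
  have "length ps \<le> length (concat (map (\<lambda>(x, g). x # g) ps))"
    by (rule Cons.IH) (simp add: first_blocks_def)
  with Cons.prems p show ?case by (auto simp: first_blocks_def)
qed simp

lemma first_blocks_full:
  assumes "ps \<in> first_blocks xs" "length ps = length xs"
  shows "ps = map (\<lambda>x. (x, [])) xs"
  using assms
proof (induction ps arbitrary: xs)
  case (Cons p ps)
  obtain x g where p: "p = (x, g)" by (cases p)
  define r where "r = concat (map (\<lambda>(x, g). x # g) ps)"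
  have xs: "xs = x # g @ r" using Cons.prems p by (simp add: first_blocks_def r_def)
  have r: "ps \<in> first_blocks r" by (simp add: first_blocks_def r_def)
  with length_first_blocks[OF r] Cons.prems(2) xs have "g = []" "length ps = length r" by auto
  with Cons.IH[OF r] xs p show ?case by simp
qed (auto simp: first_blocks_def)

lemma full_in_first_blocks: "map (\<lambda>x. (x, [])) xs \<in> first_blocks xs"
  by (induction xs) (auto simp: first_blocks_def)

lemma first_blocks_split:
  "first_blocks xs = insert (map (\<lambda>x. (x, [])) xs) {ps \<in> first_blocks xs. length ps < length xs}"
  using full_in_first_blocks[of xs] first_blocks_full[of _ xs] length_first_blocks[of _ xs]
  by (blast intro: le_neq_implies_less)

lemma bij_betw_first_blocks_map:
  "bij_betw (map (map_prod f (map f))) (first_blocks xs) (first_blocks (map f xs))"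
  unfolding bij_betw_def
proof
  have "ps = qs" if "ps \<in> first_blocks xs" "qs \<in> first_blocks xs"
    "map (map_prod f (map f)) ps = map (map_prod f (map f)) qs" for ps qs
    using that
  proof (induction ps arbitrary: qs xs)
    case (Cons p ps)
    then obtain q qs' where qs: "qs = q # qs'" by (cases qs) auto
    obtain x g y h where pq: "p = (x, g)" "q = (y, h)" by fastforce
    let ?c = "\<lambda>ps. concat (map (\<lambda>(x, g). x # g) ps)"
    have eq: "x # g @ ?c ps = y # h @ ?c qs'"
      using Cons.prems(1,2) pq qs by (simp add: first_blocks_def)
    have "length g = length h" using Cons.prems(3) pq qs by (auto dest: map_eq_imp_length_eq)
    with eq have "x = y" "g = h" "?c ps = ?c qs'" by auto
    moreover have "ps = qs'"
      by (rule Cons.IH[of "?c ps"]) (use Cons.prems(3) qs \<open>?c ps = ?c qs'\<close> in \<open>auto simp: first_blocks_def\<close>)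
    ultimately show ?case using pq qs by simp
  qed auto
  then show "inj_on (map (map_prod f (map f))) (first_blocks xs)" by (rule inj_onI)
  have "\<exists>qs \<in> first_blocks xs. ps = map (map_prod f (map f)) qs" if "ps \<in> first_blocks (map f xs)" for ps
    using that
  proof (induction ps arbitrary: xs)
    case (Cons p ps)
    obtain x g where p: "p = (x, g)" by (cases p)
    let ?c = "\<lambda>ps. concat (map (\<lambda>(x, g). x # g) ps)"
    have "map f xs = x # g @ ?c ps" using Cons.prems p by (simp add: first_blocks_def)
    then obtain y h r where xs: "xs = y # h @ r" "f y = x" "map f h = g" "map f r = ?c ps"
      by (auto simp: map_eq_Cons_conv map_eq_append_conv)
    from xs(4) have "ps \<in> first_blocks (map f r)" by (simp add: first_blocks_def)
    from Cons.IH[OF this] obtain qs where "qs \<in> first_blocks r" "ps = map (map_prod f (map f)) qs" by blast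
    with xs p show ?case by (intro bexI[of _ "(y, h) # qs"]) (auto simp: first_blocks_def)
  qed (auto simp: first_blocks_def)
  moreover have "map (map_prod f (map f)) qs \<in> first_blocks (map f xs)" if "qs \<in> first_blocks xs" for qs
    using that by (induction qs arbitrary: xs) (auto simp: first_blocks_def)
  ultimately show "map (map_prod f (map f)) ` first_blocks xs = first_blocks (map f xs)" by blast
qed

context cstar_ncps
begin

lemma E_one: "E 1 = 1"
  using E_emb[of 1] by (simp add: emb_one)

lemma E_mult_emb: "E (x * emb b) = E x * b"
  using E_bimodule[of 1 x b] by (simp add: emb_one)

lemma moment_cumulant:
  "E (prod_list xs) =
    (\<Sum>ps\<in>first_blocks xs. cumulant emb E (map (\<lambda>(x, g). x * emb (E (prod_list g))) ps))"
proof -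
  have "map (\<lambda>(x, g). x * emb (E (prod_list g))) (map (\<lambda>x. (x, [])) xs) = xs"
    by (simp add: o_def E_one emb_one)
  then show ?thesis
    by (subst first_blocks_split, subst sum.insert) (auto simp: cumulant.simps[of emb E xs])
qed

definition word :: "'a \<Rightarrow> (exponent \<times> 'b) list \<Rightarrow> 'a list"
  where "word T w = map (\<lambda>(e, b). letter T e * emb b) w"

definition alpha :: "'a \<Rightarrow> exponent \<Rightarrow> 'b \<Rightarrow> 'b"
  where "alpha T e b =
    (case e of Plain \<Rightarrow> E (T * emb b * star T) | Adjoint \<Rightarrow> E (star T * emb b * T))"

definition circ_cumulant :: "'a \<Rightarrow> (exponent \<times> 'b) list \<Rightarrow> 'b"
  where "circ_cumulant T w = (case w of
    [(e, b), (e', b')] \<Rightarrow> if e = e' then 0 else alpha T e b * b' | _ \<Rightarrow> 0)"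

definition circ_moment :: "'a \<Rightarrow> (exponent \<times> 'b) list \<Rightarrow> 'b"
  where "circ_moment T w = (\<Sum>j\<in>{j \<in> {1..<length w}. fst (w ! j) \<noteq> fst (w ! 0)}.
    alpha T (fst (w ! 0)) (snd (w ! 0) * E (prod_list (word T (take (j - 1) (tl w))))) *
    snd (w ! j) * E (prod_list (word T (drop (j + 1) w))))"

abbreviation contract :: "'a \<Rightarrow> ((exponent \<times> 'b) \<times> (exponent \<times> 'b) list) list \<Rightarrow> (exponent \<times> 'b) list"
  where "contract T qs \<equiv> map (\<lambda>((e, b), g). (e, b * E (prod_list (word T g)))) qs"

lemma moment_cumulant_word:
  "E (prod_list (word T w)) =
    (\<Sum>qs\<in>first_blocks w. cumulant emb E (word T (contract T qs)))"
proof -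
  let ?f = "\<lambda>(e, b). letter T e * emb b"
  have eq: "map (\<lambda>(x, g). x * emb (E (prod_list g))) (map (map_prod ?f (map ?f)) qs) =
      word T (contract T qs)" for qs
    by (auto simp: word_def emb_mult mult.assoc)
  have "E (prod_list (word T w)) = (\<Sum>ps\<in>first_blocks (map ?f w).
      cumulant emb E (map (\<lambda>(x, g). x * emb (E (prod_list g))) ps))"
    unfolding word_def by (rule moment_cumulant)
  also have "\<dots> = (\<Sum>qs\<in>first_blocks w. cumulant emb E
      (map (\<lambda>(x, g). x * emb (E (prod_list g))) (map (map_prod ?f (map ?f)) qs)))"
    by (rule sum.reindex_bij_betw[OF bij_betw_first_blocks_map, symmetric])
  finally show ?thesis unfolding eq .
qed

lemma sum_circ_cumulant:
  assumes "w \<noteq> []"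
  shows "(\<Sum>qs\<in>first_blocks w. circ_cumulant T (contract T qs)) = circ_moment T w"
proof -
  let ?S = "{qs \<in> first_blocks w. length qs = 2 \<and> fst (fst (qs ! 1)) \<noteq> fst (fst (qs ! 0))}"
  let ?J = "{j \<in> {1..<length w}. fst (w ! j) \<noteq> fst (w ! 0)}"
  have zero: "circ_cumulant T (contract T qs) = 0"
    if "\<not> (length qs = 2 \<and> fst (fst (qs ! 1)) \<noteq> fst (fst (qs ! 0)))" for qs
    using that by (auto simp: circ_cumulant_def split: list.splits)
  have "(\<Sum>qs\<in>first_blocks w. circ_cumulant T (contract T qs)) =
      (\<Sum>qs\<in>?S. circ_cumulant T (contract T qs))"
    by (rule sum.mono_neutral_right) (use zero in auto)
  also have "\<dots> = circ_moment T w"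
    unfolding circ_moment_def
  proof (rule sum.reindex_bij_witness[where
        i = "\<lambda>j. [(w ! 0, take (j - 1) (tl w)), (w ! j, drop (j + 1) w)]" and
        j = "\<lambda>qs. length (snd (qs ! 0)) + 1"])
    fix qs assume "qs \<in> ?S"
    then obtain e b g e' b' g' where qs: "qs = [((e, b), g), ((e', b'), g')]" "e' \<noteq> e"
      and w: "w = (e, b) # g @ (e', b') # g'"
      by (auto simp: first_blocks_def length_Suc_conv numeral_2_eq_2)
    show "[(w ! 0, take (length (snd (qs ! 0)) + 1 - 1) (tl w)),
        (w ! (length (snd (qs ! 0)) + 1), drop (length (snd (qs ! 0)) + 1 + 1) w)] = qs"
      using qs w by simp
    show "length (snd (qs ! 0)) + 1 \<in> ?J" using qs w by simp
    show "alpha T (fst (w ! 0)) (snd (w ! 0) *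
          E (prod_list (word T (take (length (snd (qs ! 0)) + 1 - 1) (tl w))))) *
        snd (w ! (length (snd (qs ! 0)) + 1)) *
        E (prod_list (word T (drop (length (snd (qs ! 0)) + 1 + 1) w))) =
        circ_cumulant T (contract T qs)"
      using qs w by (simp add: circ_cumulant_def mult.assoc)
  next
    fix j assume "j \<in> ?J"
    then have j: "1 \<le> j" "j < length w" "fst (w ! j) \<noteq> fst (w ! 0)" by auto
    then obtain a r where w: "w = a # r" by (cases w) auto
    obtain i where i: "j = Suc i" using j by (cases j) auto
    show "length (snd ([(w ! 0, take (j - 1) (tl w)), (w ! j, drop (j + 1) w)] ! 0)) + 1 = j"
      using j w i by simp
    show "[(w ! 0, take (j - 1) (tl w)), (w ! j, drop (j + 1) w)] \<in> ?S"
      using j w i by (auto simp: first_blocks_def id_take_nth_drop[symmetric])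
  qed
  finally show ?thesis .
qed

lemma cumulants_iff_moments:
  "(\<forall>w. w \<noteq> [] \<longrightarrow> cumulant emb E (word T w) = circ_cumulant T w) \<longleftrightarrow>
   (\<forall>w. w \<noteq> [] \<longrightarrow> E (prod_list (word T w)) = circ_moment T w)"
proof (intro iffI allI impI)
  fix w :: "(exponent \<times> 'b) list"
  assume *: "\<forall>w. w \<noteq> [] \<longrightarrow> cumulant emb E (word T w) = circ_cumulant T w" and w: "w \<noteq> []"
  have "qs \<noteq> []" if "qs \<in> first_blocks w" for qs
    using that w by (auto simp: first_blocks_def)
  then have "(\<Sum>qs\<in>first_blocks w. cumulant emb E (word T (contract T qs))) =
      (\<Sum>qs\<in>first_blocks w. circ_cumulant T (contract T qs))"
    by (intro sum.cong) (auto simp: *)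
  then show "E (prod_list (word T w)) = circ_moment T w"
    by (simp only: moment_cumulant_word[symmetric] sum_circ_cumulant[OF w])
next
  fix w :: "(exponent \<times> 'b) list"
  assume *: "\<forall>w. w \<noteq> [] \<longrightarrow> E (prod_list (word T w)) = circ_moment T w" and w: "w \<noteq> []"
  then show "cumulant emb E (word T w) = circ_cumulant T w"
  proof (induction w rule: length_induct)
    case (1 w)
    let ?P = "{qs \<in> first_blocks w. length qs < length w}"
    have full: "contract T (map (\<lambda>x. (x, [])) w) = w"
      by (simp add: o_def E_one word_def case_prod_unfold)
    have sum_split: "sum h (first_blocks w) = h (map (\<lambda>x. (x, [])) w) + sum h ?P"
      for h :: "_ \<Rightarrow> 'b"
      by (subst first_blocks_split, subst sum.insert) auto
    have "(\<Sum>qs\<in>first_blocks w. cumulant emb E (word T (contract T qs))) =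
        (\<Sum>qs\<in>first_blocks w. circ_cumulant T (contract T qs))"
      using 1(2)[rule_format, OF 1(3)]
      by (simp only: moment_cumulant_word[symmetric] sum_circ_cumulant[OF 1(3)])
    moreover have "(\<Sum>qs\<in>?P. cumulant emb E (word T (contract T qs))) =
        (\<Sum>qs\<in>?P. circ_cumulant T (contract T qs))"
    proof (rule sum.cong)
      fix qs assume qs: "qs \<in> ?P"
      then have "qs \<noteq> []" using 1(3) by (auto simp: first_blocks_def)
      with qs 1(1,2) show "cumulant emb E (word T (contract T qs)) = circ_cumulant T (contract T qs)"
        by simp
    qed simp
    ultimately show ?case by (simp only: sum_split full add_right_cancel)
  qed
qed

lemma word_index:
  "word T (map (\<lambda>j. (\<epsilon> j, b j)) [m..<n]) = map (\<lambda>j. letter T (\<epsilon> j) * emb (b j)) [m..<n]"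
  by (simp add: word_def)

lemma ex_index:
  obtains \<epsilon> b where "w = map (\<lambda>j. (\<epsilon> j, b j)) [1..<length w + 1]"
proof
  show "w = map (\<lambda>j. (fst (w ! (j - 1)), snd (w ! (j - 1)))) [1..<length w + 1]"
    by (rule nth_equalityI) (auto simp del: upt_Suc)
qed

lemma exponent_neq: "e \<noteq> e' \<longleftrightarrow> e = Plain \<and> e' = Adjoint \<or> e = Adjoint \<and> e' = Plain"
  by (cases e; cases e') auto

lemma cumulant_single: "cumulant emb E [x] = E x"
proof -
  have "{ps \<in> first_blocks [x]. length ps < length [x]} = {}"
    by (auto simp: first_blocks_def)
  then show ?thesis by (subst cumulant.simps) (simp only:, simp)
qed

lemma circular_iff_cumulants:
  "circular emb E T \<longleftrightarrow> (\<forall>w. w \<noteq> [] \<longrightarrow> cumulant emb E (word T w) = circ_cumulant T w)"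
proof
  assume circ: "circular emb E T"
  show "\<forall>w. w \<noteq> [] \<longrightarrow> cumulant emb E (word T w) = circ_cumulant T w"
  proof (intro allI impI)
    fix w :: "(exponent \<times> 'b) list" assume "w \<noteq> []"
    show "cumulant emb E (word T w) = circ_cumulant T w"
    proof (cases "\<exists>e b e' b'. w = [(e, b), (e', b')] \<and> e \<noteq> e'")
      case True
      with circ show ?thesis
        by (auto simp: circular_def word_def circ_cumulant_def alpha_def exponent_neq)
    next
      case False
      obtain \<epsilon> b where w: "w = map (\<lambda>j. (\<epsilon> j, b j)) [1..<length w + 1]" by (rule ex_index)
      have "\<not> (length w = 2 \<and> \<epsilon> 1 \<noteq> \<epsilon> 2)"
      proof
        assume "length w = 2 \<and> \<epsilon> 1 \<noteq> \<epsilon> 2"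
        moreover from this w have "w = [(\<epsilon> 1, b 1), (\<epsilon> 2, b 2)]" by (simp add: upt_rec numeral_2_eq_2)
        ultimately show False using False by auto
      qed
      moreover have "1 \<le> length w" using \<open>w \<noteq> []\<close> by (cases w) auto
      ultimately have "cumulant emb E (map (\<lambda>j. letter T (\<epsilon> j) * emb (b j)) [1..<length w + 1]) = 0"
        using circ unfolding circular_def by blast
      then have "cumulant emb E (word T w) = 0"
        by (subst w) (simp only: word_index)
      moreover have "circ_cumulant T w = 0"
        using False by (auto simp: circ_cumulant_def split: list.splits)
      ultimately show ?thesis by simp
    qed
  qed
next
  assume cum: "\<forall>w. w \<noteq> [] \<longrightarrow> cumulant emb E (word T w) = circ_cumulant T w"
  show "circular emb E T"
    unfolding circular_def
  proof (intro conjI allI impI)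
    show "E T = 0"
      using cum[rule_format, of "[(Plain, 1)]"]
      by (simp add: word_def emb_one cumulant_single circ_cumulant_def)
    show "cumulant emb E [T * emb b, star T * emb c] = E (T * emb b * star T) * c" for b c
      using cum[rule_format, of "[(Plain, b), (Adjoint, c)]"]
      by (simp add: word_def circ_cumulant_def alpha_def)
    show "cumulant emb E [star T * emb b, T * emb c] = E (star T * emb b * T) * c" for b c
      using cum[rule_format, of "[(Adjoint, b), (Plain, c)]"]
      by (simp add: word_def circ_cumulant_def alpha_def)
    fix n :: nat and \<epsilon> :: "nat \<Rightarrow> exponent" and b :: "nat \<Rightarrow> 'b"
    assume n: "1 \<le> n \<and> \<not> (n = 2 \<and> \<epsilon> 1 \<noteq> \<epsilon> 2)"
    define w where "w = map (\<lambda>j. (\<epsilon> j, b j)) [1..<n+1]"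
    have "circ_cumulant T w = 0"
    proof (cases "n = 2")
      case True
      then have "w = [(\<epsilon> 1, b 1), (\<epsilon> 2, b 2)]" by (simp add: w_def upt_rec numeral_2_eq_2)
      then show ?thesis using n True by (simp add: circ_cumulant_def)
    next
      case False
      then have "length w \<noteq> 2" by (simp add: w_def)
      then show ?thesis by (auto simp: circ_cumulant_def split: list.splits)
    qed
    moreover have "w \<noteq> []" using n by (simp add: w_def)
    ultimately have "cumulant emb E (word T w) = 0" using cum by simp
    then show "cumulant emb E (map (\<lambda>j. letter T (\<epsilon> j) * emb (b j)) [1..<n+1]) = 0"
      by (simp only: w_def word_index)
  qed
qed

lemma circ_moment_index:
  assumes "1 \<le> n"
  shows "circ_moment T (map (\<lambda>j. (\<epsilon> j, b j)) [1..<n+1]) =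
    (\<Sum>j\<in>{j \<in> {2..n}. \<epsilon> j \<noteq> \<epsilon> 1}.
      alpha T (\<epsilon> 1) (b 1 * E (prod_list (map (\<lambda>i. letter T (\<epsilon> i) * emb (b i)) [2..<j]))) *
      b j * E (prod_list (map (\<lambda>i. letter T (\<epsilon> i) * emb (b i)) [j+1..<n+1])))"
proof -
  define w where "w = map (\<lambda>j. (\<epsilon> j, b j)) [1..<n+1]"
  have len: "length w = n" by (simp add: w_def)
  have nth: "w ! i = (\<epsilon> (i + 1), b (i + 1))" if "i < n" for i
    using that by (simp add: w_def del: upt_Suc)
  have "tl w = map (\<lambda>j. (\<epsilon> j, b j)) [2..<n+1]"
    using assms by (simp add: w_def map_tl[symmetric] numeral_2_eq_2 del: upt_Suc)
  then have take: "word T (take j (tl w)) = map (\<lambda>i. letter T (\<epsilon> i) * emb (b i)) [2..<j+2]"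
    if "j + 1 < n" for j
    using that by (simp add: word_def take_map take_upt del: upt_Suc)
  have drop: "word T (drop j w) = map (\<lambda>i. letter T (\<epsilon> i) * emb (b i)) [j+1..<n+1]" for j
    by (simp add: word_def w_def drop_map del: upt_Suc)
  show ?thesis
    unfolding w_def[symmetric] circ_moment_def len
  proof (rule sum.reindex_bij_witness[where i = "\<lambda>j. j - 1" and j = "\<lambda>j. j + 1"])
    fix j assume "j \<in> {j \<in> {1..<n}. fst (w ! j) \<noteq> fst (w ! 0)}"
    then have j: "1 \<le> j" "j < n" by auto
    then have "word T (take (j - 1) (tl w)) = map (\<lambda>i. letter T (\<epsilon> i) * emb (b i)) [2..<j+1]"
      using take[of "j - 1"] by (simp del: upt_Suc)
    then show "alpha T (\<epsilon> 1) (b 1 * E (prod_list (map (\<lambda>i. letter T (\<epsilon> i) * emb (b i)) [2..<j+1]))) *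
        b (j+1) * E (prod_list (map (\<lambda>i. letter T (\<epsilon> i) * emb (b i)) [j+1+1..<n+1])) =
        alpha T (fst (w ! 0)) (snd (w ! 0) * E (prod_list (word T (take (j - 1) (tl w))))) *
        snd (w ! j) * E (prod_list (word T (drop (j + 1) w)))"
      using j by (simp only: drop) (simp add: nth del: upt_Suc)
  qed (use assms in \<open>auto simp: nth\<close>)
qed

theorem circular_iff_moment_formula:
  "circular emb E T \<longleftrightarrow>
    (\<forall>n \<epsilon> b. 1 \<le> n \<longrightarrow>
      E (prod_list (map (\<lambda>j. letter T (\<epsilon> j) * emb (b j)) [1..<n+1])) =
      (\<Sum>j\<in>{j \<in> {2..n}. \<epsilon> j \<noteq> \<epsilon> 1}.
        alpha T (\<epsilon> 1) (b 1 * E (prod_list (map (\<lambda>i. letter T (\<epsilon> i) * emb (b i)) [2..<j]))) *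
        b j * E (prod_list (map (\<lambda>i. letter T (\<epsilon> i) * emb (b i)) [j+1..<n+1]))))"
  (is "_ \<longleftrightarrow> ?R")
proof -
  have "?R \<longleftrightarrow> (\<forall>w. w \<noteq> [] \<longrightarrow> E (prod_list (word T w)) = circ_moment T w)" (is "_ \<longleftrightarrow> ?Q")
  proof
    assume R: ?R
    show ?Q
    proof (intro allI impI)
      fix w :: "(exponent \<times> 'b) list" assume "w \<noteq> []"
      then have n: "1 \<le> length w" by (cases w) auto
      obtain \<epsilon> b where w: "w = map (\<lambda>j. (\<epsilon> j, b j)) [1..<length w + 1]" by (rule ex_index)
      have "E (prod_list (word T (map (\<lambda>j. (\<epsilon> j, b j)) [1..<length w + 1]))) =
          circ_moment T (map (\<lambda>j. (\<epsilon> j, b j)) [1..<length w + 1])"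
        unfolding word_index circ_moment_index[OF n] by (rule R[rule_format, OF n])
      then show "E (prod_list (word T w)) = circ_moment T w"
        by (simp only: w[symmetric])
    qed
  next
    assume Q: ?Q
    show ?R
    proof (intro allI impI)
      fix n :: nat and \<epsilon> :: "nat \<Rightarrow> exponent" and b :: "nat \<Rightarrow> 'b" assume n: "1 \<le> n"
      then have "map (\<lambda>j. (\<epsilon> j, b j)) [1..<n+1] \<noteq> []" by simp
      from Q[rule_format, OF this] show
        "E (prod_list (map (\<lambda>j. letter T (\<epsilon> j) * emb (b j)) [1..<n+1])) =
        (\<Sum>j\<in>{j \<in> {2..n}. \<epsilon> j \<noteq> \<epsilon> 1}.
          alpha T (\<epsilon> 1) (b 1 * E (prod_list (map (\<lambda>i. letter T (\<epsilon> i) * emb (b i)) [2..<j]))) *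
          b j * E (prod_list (map (\<lambda>i. letter T (\<epsilon> i) * emb (b i)) [j+1..<n+1])))"
        unfolding word_index circ_moment_index[OF n] .
    qed
  qed
  then show ?thesis
    by (simp only: circular_iff_cumulants cumulants_iff_moments)
qed

end

end

theory Submission
  imports Defs
begin

text \<open>
  The moment formula for a circular element expresses \<open>E (T\<^bsup>\<epsilon>(1)\<^esup> b\<^sub>1 \<cdots> T\<^bsup>\<epsilon>(n)\<^esup> b\<^sub>n)\<close> through sums, products in the
  commutative algebra \<open>B\<close>, and the positive maps \<open>alpha T e\<close>.  If \<open>B\<close> is viewed as an algebra of
  functions, replacing every \<open>b\<^sub>j\<close> by the scalar \<open>norm b\<^sub>j\<close> can therefore only increase the moment
  pointwise in absolute value (\<open>dominates_moment\<close>).  For \<open>x = T\<^bsup>\<epsilon>(1)\<^esup> b\<^sub>1 \<cdots> T\<^bsup>\<epsilon>(n)\<^esup> b\<^sub>n\<close> and the word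
  \<open>y = (\<Prod>j. norm b\<^sub>j) T\<^bsup>\<epsilon>(1)\<^esup> \<cdots> T\<^bsup>\<epsilon>(n)\<^esup>\<close> this applies to all moments of \<open>star x * x\<close> and \<open>star y * y\<close>.  As \<open>E\<close> is
  faithful, the norm of \<open>star x * x\<close> is at most the growth rate of its moments
  (\<open>norm_le_of_even_moments\<close>), so \<open>norm x \<le> norm y\<close> (\<open>monomial_dominates_norm_le\<close>).

  The proof does not represent \<open>B\<close> by functions.  Absolute values are replaced by the relation
  \<open>dominates\<close>, which is stable under the operations in the moment formula by construction; its
  substance lies in the fact that \<open>b\<close> is dominated by every scalar larger than its norm
  (\<open>dominates_of_norm_less\<close>), shown with a discrete Poisson kernel, and that domination controls the
  norm (\<open>dominates_norm_le\<close>).  The order theory rests on one analytic tool, the square root of a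
  self-adjoint \<open>c\<close> with \<open>norm (1 - c) \<le> 1\<close> given by the binomial series (\<open>ex_sqrt_near_one\<close>).

  For quasinilpotence, the same comparison bounds the powers of \<open>emb b\<^sub>1 * T * emb b\<^sub>2\<close> by those of a
  scalar multiple of \<open>T\<close>, and \<open>quasinilpotent_iff_powers\<close>, a case of the spectral radius formula,
  translates between powers and the spectrum.
\<close>

section \<open>Square roots of self-adjoint elements\<close>

lemma star_zero [simp]: "star (0::'a::cstar_algebra) = 0"
  using star_add[of "0::'a" 0] by simp

lemma star_one [simp]: "star (1::'a::cstar_algebra) = 1"
proof -
  have "star (star 1 * 1 :: 'a) = star (star 1)" by simp
  then show ?thesis by (metis mult_1_left star_mult star_star mult_1_right)
qed

lemma star_scaleR [simp]: "star (t *\<^sub>R x) = t *\<^sub>R star (x::'a::cstar_algebra)"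
  by (simp add: scaleR_scaleC star_scaleC)

lemma star_minus [simp]: "star (- x) = - star (x::'a::cstar_algebra)"
  using star_scaleR[of "-1" x] by simp

lemma star_diff: "star (x - y) = star x - star (y::'a::cstar_algebra)"
  using star_add[of x "-y"] by simp

lemma star_power: "star (x ^ n) = star (x::'a::cstar_algebra) ^ n"
  by (induction n) (simp_all add: star_mult power_commutes)

lemma norm_star [simp]: "norm (star x) = norm (x::'a::cstar_algebra)"
proof -
  have le: "norm y \<le> norm (star y)" for y :: 'a
  proof (cases "y = 0")
    case False
    have "norm y * norm y \<le> norm (star y) * norm y"
      using norm_mult_ineq[of "star y" y] by (simp add: cstar_identity power2_eq_square)
    with False show ?thesis by simp
  qed simp
  from le[of x] le[of "star x"] show ?thesis by (simp add: star_star)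
qed

lemma bounded_linear_star: "bounded_linear (star :: 'a::cstar_algebra \<Rightarrow> 'a)"
  by (rule bounded_linear_intro[of _ 1]) (simp_all add: star_add)

text \<open>
  The Taylor coefficients of the square root of \<open>1 - X\<close>.  All but the first are \<open>\<le> 0\<close> while every
  partial sum is \<open>\<ge> 0\<close>, so the series converges absolutely up to the boundary of the unit disc,
  and the coefficients after the first have absolute sum at most 1.
\<close>
definition sqrt_coeff :: "nat \<Rightarrow> real"
  where "sqrt_coeff n = (1/2 gchoose n) * (-1) ^ n"

lemma sqrt_coeff_0: "sqrt_coeff 0 = 1"
  by (simp add: sqrt_coeff_def)

lemma sqrt_coeff_nonpos: "sqrt_coeff (Suc n) \<le> 0"
proof -
  have "sqrt_coeff (Suc n) = pochhammer (-1/2) (Suc n) / fact (Suc n)"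
    by (simp add: sqrt_coeff_def gbinomial_pochhammer mult.commute power_mult_distrib[symmetric] del: power_Suc)
  also have "pochhammer (-1/2) (Suc n) = (-1/2) * pochhammer (1/2::real) n"
    by (simp add: pochhammer_rec)
  finally show ?thesis
    by (simp add: divide_nonneg_nonneg pochhammer_nonneg)
qed

lemma sum_sqrt_coeff: "(\<Sum>n\<le>m. sqrt_coeff n) \<ge> 0"
proof -
  \<comment> \<open>the partial sums of the coefficients are the coefficients of \<open>(1 - X) powr (-1/2)\<close>\<close>
  have "(\<Sum>n\<le>m. sqrt_coeff n) = (-1) ^ m * (-1/2 gchoose m)"
    using gbinomial_sum_lower_neg[of "1/2::real" m] by (simp add: sqrt_coeff_def)
  also have "\<dots> = pochhammer (1/2) m / fact m"
    by (simp add: gbinomial_pochhammer power_mult_distrib[symmetric])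
  finally show ?thesis by (simp add: pochhammer_nonneg)
qed

lemma summable_sqrt_coeff_Suc: "summable (\<lambda>n. - sqrt_coeff (Suc n))"
  and suminf_sqrt_coeff_Suc: "(\<Sum>n. - sqrt_coeff (Suc n)) \<le> 1"
proof -
  have bound: "(\<Sum>i<n. - sqrt_coeff (Suc i)) \<le> 1" for n
    using sum_sqrt_coeff[of n]
    by (simp add: sum.atMost_shift sqrt_coeff_0 sum_negf)
  show s: "summable (\<lambda>n. - sqrt_coeff (Suc n))"
  proof (rule bounded_imp_summable)
    show "(\<Sum>i\<le>n. - sqrt_coeff (Suc i)) \<le> 1" for n
      using bound[of "Suc n"] by (simp only: lessThan_Suc_atMost)
  qed (use sqrt_coeff_nonpos in simp)
  show "(\<Sum>n. - sqrt_coeff (Suc n)) \<le> 1"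
    by (rule suminf_le_const[OF s bound])
qed

lemma sqrt_coeff_Cauchy: "(\<Sum>i\<le>n. sqrt_coeff i * sqrt_coeff (n - i)) = (1 gchoose n) * (-1) ^ n"
proof -
  have "(\<Sum>i\<le>n. sqrt_coeff i * sqrt_coeff (n - i)) = 
     (\<Sum>i\<le>n. (1/2 gchoose i) * (1/2 gchoose (n - i))) * (-1) ^ n"
    unfolding sum_distrib_right
    by (intro sum.cong refl) (simp add: sqrt_coeff_def flip: power_add)
  then show ?thesis
    using gbinomial_Vandermonde[of "1/2::real" "1/2" n] by (simp add: atLeast0AtMost)
qed

text \<open>
  Insert \<open>1 - c\<close> into the power series of the square root of \<open>1 - X\<close>.  The bound on \<open>1 - k\<close> makes
  it possible to take the square root of \<open>k\<close> again.  The statement about commutation holds because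
  \<open>k\<close> is a limit of polynomials in \<open>c\<close>; it replaces passing to the commutative subalgebra
  generated by \<open>c\<close>.
\<close>
lemma ex_sqrt_near_one:
  fixes c :: "'a::cstar_algebra"
  assumes sa: "star c = c" and norm: "norm (1 - c) \<le> 1"
  obtains k where "star k = k" "k * k = c" "norm (1 - k) \<le> 1"
    "\<And>z. z * c = c * z \<Longrightarrow> z * k = k * z"
proof -
  define x where "x = 1 - c"
  define f where "f n = sqrt_coeff n *\<^sub>R x ^ n" for n
  have pow: "norm (x ^ n) \<le> 1" for n
    using norm norm_power_ineq[of x n] power_le_one[of "norm x" n] by (simp add: x_def)
  have f_bound: "norm (f n) \<le> \<bar>sqrt_coeff n\<bar>" for n
    unfolding f_def using mult_left_mono[OF pow[of n], of "\<bar>sqrt_coeff n\<bar>"] by simp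
  have "summable (\<lambda>n. \<bar>sqrt_coeff (Suc n)\<bar>)"
    using summable_sqrt_coeff_Suc sqrt_coeff_nonpos by (simp add: abs_of_nonpos)
  then have "summable (\<lambda>n. \<bar>sqrt_coeff n\<bar>)" by (subst (asm) summable_Suc_iff)
  then have sn: "summable (\<lambda>n. norm (f n))"
    by (rule summable_comparison_test'[of _ 0]) (simp add: f_bound)
  then have sf: "summable f" by (rule summable_norm_cancel)
  define k where "k = suminf f"
  have fk: "f sums k" unfolding k_def using sf by (rule summable_sums)
  have x_sa: "star x = x" by (simp add: x_def star_diff sa)
  show ?thesis
  proof
    have "(\<lambda>n. star (f n)) sums star k"
      by (rule bounded_linear.sums[OF bounded_linear_star fk])
    moreover have "star (f n) = f n" for n by (simp add: f_def star_power x_sa)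
    ultimately have "f sums star k" by simp
    then show "star k = k" using fk by (rule sums_unique2)
    have "(\<lambda>n. \<Sum>i\<le>n. f i * f (n - i)) sums (k * k)"
      unfolding k_def by (rule Cauchy_product_sums[OF sn sn])
    also have "(\<lambda>n. \<Sum>i\<le>n. f i * f (n - i)) = (\<lambda>n. ((1 gchoose n) * (-1) ^ n) *\<^sub>R x ^ n)"
      by (simp add: f_def mult.commute flip: power_add sqrt_coeff_Cauchy scaleR_sum_left)
    finally have "(\<lambda>n. ((1 gchoose n) * (-1) ^ n) *\<^sub>R x ^ n) sums (k * k)" .
    moreover have "(\<lambda>n. ((1 gchoose n) * (-1) ^ n) *\<^sub>R x ^ n) sums (\<Sum>n\<in>{..1}. ((1 gchoose n) * (-1) ^ n) *\<^sub>R x ^ n)"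
    proof (rule sums_finite)
      fix n :: nat assume "n \<notin> {..1}"
      then have "(1::real) gchoose n = 0"
        using binomial_gbinomial[of 1 n, where 'a = real] by (simp add: binomial_eq_0)
      then show "((1 gchoose n) * (-1) ^ n) *\<^sub>R x ^ n = 0" by simp
    qed simp
    ultimately have "k * k = (\<Sum>n\<in>{..1}. ((1 gchoose n) * (-1) ^ n) *\<^sub>R x ^ n)" by (rule sums_unique2)
    then show "k * k = c" by (simp add: x_def)
    have "(\<lambda>n. f (Suc n)) sums (k - f 0)" using fk by (subst sums_Suc_iff) simp
    then have tail: "(\<lambda>n. f (Suc n)) sums (k - 1)" by (simp add: f_def sqrt_coeff_0)
    have "norm (\<Sum>n. f (Suc n)) \<le> (\<Sum>n. - sqrt_coeff (Suc n))"
      using f_bound[of "Suc _"] sqrt_coeff_nonpos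
      by (intro norm_suminf_le summable_sqrt_coeff_Suc) (simp add: abs_of_nonpos)
    with suminf_sqrt_coeff_Suc show "norm (1 - k) \<le> 1"
      by (simp only: sums_unique[OF tail, symmetric] norm_minus_commute[of 1 k])
    fix z assume "z * c = c * z"
    then have zx: "z * x = x * z" by (simp add: x_def algebra_simps)
    have "z * f n = f n * z" for n
      using power_commuting_commutes[OF zx[symmetric], of n] by (simp add: f_def)
    moreover have "(\<lambda>n. z * f n) sums (z * k)" "(\<lambda>n. f n * z) sums (k * z)"
      by (simp_all add: sums_mult sums_mult2 fk)
    ultimately show "z * k = k * z" by (simp add: sums_unique2)
  qed
qed

lemma scaleC_zero_right [simp]: "scaleC c (0::'a::cstar_algebra) = 0"
  using scaleC_add_right[of c "0::'a" 0] by simp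

lemma scaleC_zero_left [simp]: "scaleC 0 (x::'a::cstar_algebra) = 0"
  using scaleC_add_left[of 0 0 x] by simp

lemma scaleC_minus_left: "scaleC (- c) x = - scaleC c (x::'a::cstar_algebra)"
  using scaleC_add_left[of c "-c" x] by (simp add: add_eq_0_iff)

lemma scaleC_minus_right: "scaleC c (- x) = - scaleC c (x::'a::cstar_algebra)"
  using scaleC_add_right[of c x "-x"] by (simp add: add_eq_0_iff)

lemma scaleC_diff_right: "scaleC c (x - y) = scaleC c x - scaleC c (y::'a::cstar_algebra)"
  using scaleC_add_right[of c x "-y"] by (simp add: scaleC_minus_right)

lemma scaleC_diff_left: "scaleC (c - d) x = scaleC c x - scaleC d (x::'a::cstar_algebra)"
  using scaleC_add_left[of c "-d" x] by (simp add: scaleC_minus_left)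

lemma scaleC_sum_right: "scaleC c (sum f A) = (\<Sum>i\<in>A. scaleC c (f i :: 'a::cstar_algebra))"
  by (induction A rule: infinite_finite_induct) (simp_all add: scaleC_add_right)

lemma scaleC_sum_left: "scaleC (sum f A) x = (\<Sum>i\<in>A. scaleC (f i) (x :: 'a::cstar_algebra))"
  by (induction A rule: infinite_finite_induct) (simp_all add: scaleC_add_left)

lemma scaleC_power: "scaleC c x ^ n = scaleC (c ^ n) ((x::'a::cstar_algebra) ^ n)"
  by (induction n) (simp_all add: scaleC_one mult_scaleC_left mult_scaleC_right scaleC_scaleC mult.commute[of c])

lemma cartesian_decomposition:
  fixes x :: "'a::cstar_algebra"
  obtains h k where "star h = h" "star k = k" "x = h + scaleC \<i> k"
proof
  let ?h = "scaleC (1/2) (x + star x)" and ?k = "scaleC (- \<i>/2) (x - star x)"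
  show "star ?h = ?h" by (simp add: star_scaleC star_add star_star add.commute)
  have "star ?k = scaleC (\<i>/2) (star x - x)" by (simp add: star_scaleC star_diff star_star)
  also have "\<dots> = ?k" by (simp add: scaleC_minus_left scaleC_diff_right)
  finally show "star ?k = ?k" .
  have "scaleC \<i> ?k = scaleC (1/2) (x - star x)" by (simp add: scaleC_scaleC)
  moreover have "scaleC (1/2) x + scaleC (1/2) x = x"
    by (simp add: scaleC_one flip: scaleC_add_left)
  ultimately show "x = ?h + scaleC \<i> ?k"
    by (simp add: scaleC_add_right scaleC_diff_right)
qed

lemma norm_cartesian:
  fixes h k :: "'a::cstar_algebra"
  assumes h: "star h = h" and k: "star k = k"
  shows "norm h \<le> norm (h + scaleC \<i> k)" and "norm k \<le> norm (h + scaleC \<i> k)"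
proof -
  let ?u = "h + scaleC \<i> k"
  have su: "star ?u = h - scaleC \<i> k"
    by (simp add: star_add star_scaleC h k scaleC_minus_left)
  have "norm (2 *\<^sub>R h) \<le> norm ?u + norm (star ?u)"
    using norm_triangle_ineq[of ?u "star ?u"] unfolding su by (simp add: scaleR_2)
  then show "norm h \<le> norm ?u" by simp
  have "?u - star ?u = scaleC \<i> (2 *\<^sub>R k)" unfolding su by (simp add: scaleR_2 scaleC_add_right)
  then have "norm (2 *\<^sub>R k) = norm (?u - star ?u)" by (simp add: norm_scaleC)
  also have "\<dots> \<le> norm ?u + norm (star ?u)" by (rule norm_triangle_ineq4)
  finally show "norm k \<le> norm ?u" by simp
qed

lemma star_mult_cartesian:
  fixes h k :: "'a::cstar_algebra"
  assumes h: "star h = h" and k: "star k = k" and comm: "h * k = k * h"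
  shows "star (h + scaleC \<i> k) * (h + scaleC \<i> k) = h * h + k * k"
proof -
  have su: "star (h + scaleC \<i> k) = h - scaleC \<i> k"
    by (simp add: star_add star_scaleC h k scaleC_minus_left)
  show ?thesis
    unfolding su by (simp add: algebra_simps mult_scaleC_left mult_scaleC_right scaleC_scaleC scaleC_minus_left
        scaleC_diff_right scaleC_one comm)
qed

text \<open>
  The element \<open>h + \<i> k\<close> is normal with \<open>star (h + \<i> k) * (h + \<i> k) = M\<^sup>2\<close>, hence has norm \<open>M\<close>, and
  the real and imaginary parts of an element are no larger than the element.
\<close>
lemma norm_le_of_sum_squares:
  fixes h k :: "'a::cstar_algebra"
  assumes h: "star h = h" and k: "star k = k" and comm: "h * k = k * h"
    and sum: "h * h + k * k = M\<^sup>2 *\<^sub>R 1" and M: "0 \<le> M"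
  shows "norm h \<le> M" "norm k \<le> M"
proof -
  let ?u = "h + scaleC \<i> k"
  have "(norm ?u)\<^sup>2 = M\<^sup>2"
    unfolding cstar_identity[symmetric] star_mult_cartesian[OF h k comm] sum by simp
  with M have "norm ?u = M" by simp
  with norm_cartesian[OF h k] show "norm h \<le> M" "norm k \<le> M" by auto
qed

lemma norm_square_sa:
  fixes h :: "'a::cstar_algebra"
  assumes "star h = h"
  shows "norm (h * h) = (norm h)\<^sup>2"
  using cstar_identity[of h] assms by simp

text \<open>
  This is what makes squares of self-adjoint elements positive in the metric sense of
  Kelley and Vaught, without any use of the spectrum.
\<close>
lemma norm_one_minus_square_le:
  fixes h :: "'a::cstar_algebra"
  assumes h: "star h = h" and le: "norm h \<le> 1"
  shows "norm (1 - h * h) \<le> 1"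
proof -
  have sa: "star (1 - h * h) = 1 - h * h" by (simp add: star_diff star_mult h)
  have n: "norm (1 - (1 - h * h)) \<le> 1"
    using le by (simp add: norm_square_sa[OF h] power_le_one)
  obtain k where k: "star k = k" "k * k = 1 - h * h" and "norm (1 - k) \<le> 1"
    and comm: "\<And>z. z * (1 - h * h) = (1 - h * h) * z \<Longrightarrow> z * k = k * z"
    by (rule ex_sqrt_near_one[OF sa n]) blast
  \<comment> \<open>\<open>h + \<i> k\<close> is unitary, so its imaginary part \<open>k\<close> is a contraction, and so is \<open>1 - h\<^sup>2 = k\<^sup>2\<close>\<close>
  have "h * k = k * h" by (rule comm) (simp add: algebra_simps)
  then have "norm k \<le> 1"
    using norm_le_of_sum_squares(2)[OF h k(1), of 1] by (simp add: k(2))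
  then show ?thesis
    using norm_square_sa[OF k(1)] by (simp add: k(2) power_le_one)
qed

text \<open>For a self-adjoint \<open>c\<close> the norm bound says that the spectrum of \<open>c\<close> lies in \<open>[0, 2t]\<close>.\<close>

lemma ex_sqrt:
  fixes c :: "'a::cstar_algebra"
  assumes sa: "star c = c" and norm: "norm (t *\<^sub>R 1 - c) \<le> t"
  obtains k where "star k = k" "k * k = c" "\<And>z. z * c = c * z \<Longrightarrow> z * k = k * z"
proof (cases "t = 0")
  case True
  with norm have "c = 0" by simp
  show ?thesis by (rule that[of 0]) (simp_all add: \<open>c = 0\<close>)
next
  case False
  have "0 \<le> t" using norm norm_ge_zero[of "t *\<^sub>R 1 - c"] by linarith
  with False have t: "0 < t" by simp
  have "norm (1 - (1/t) *\<^sub>R c) = norm ((1/t) *\<^sub>R (t *\<^sub>R 1 - c))"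
    using t by (simp add: scaleR_diff_right)
  also have "\<dots> \<le> 1" using norm t by simp
  finally have n: "norm (1 - (1/t) *\<^sub>R c) \<le> 1" .
  have s: "star ((1/t) *\<^sub>R c) = (1/t) *\<^sub>R c" by (simp add: sa)
  obtain k where k: "star k = k" "k * k = (1/t) *\<^sub>R c" "norm (1 - k) \<le> 1"
    "\<And>z. z * ((1/t) *\<^sub>R c) = ((1/t) *\<^sub>R c) * z \<Longrightarrow> z * k = k * z"
    by (rule ex_sqrt_near_one[OF s n]) blast
  show ?thesis
  proof (rule that[of "sqrt t *\<^sub>R k"])
    show "sqrt t *\<^sub>R k * sqrt t *\<^sub>R k = c" using k(2) t by simp
    show "star (sqrt t *\<^sub>R k) = sqrt t *\<^sub>R k" by (simp add: k(1))
    show "z * sqrt t *\<^sub>R k = sqrt t *\<^sub>R k * z" if "z * c = c * z" for z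
      using k(4)[of z] that by simp
  qed
qed

lemma ex_sqrt_norm_minus:
  fixes z :: "'a::cstar_algebra"
  assumes sa: "star z = z" and norm: "norm z \<le> M"
  obtains v where "star v = v" "v * v = M *\<^sub>R 1 - z" "\<And>y. y * z = z * y \<Longrightarrow> y * v = v * y"
proof -
  have s: "star (M *\<^sub>R 1 - z) = M *\<^sub>R 1 - z" by (simp add: star_diff sa)
  have n: "norm (M *\<^sub>R 1 - (M *\<^sub>R 1 - z)) \<le> M" using norm by simp
  obtain v where v: "star v = v" "v * v = M *\<^sub>R 1 - z"
    and comm: "\<And>y. y * (M *\<^sub>R 1 - z) = (M *\<^sub>R 1 - z) * y \<Longrightarrow> y * v = v * y"
    by (rule ex_sqrt[OF s n]) blast
  show ?thesis
  proof (rule that[OF v])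
    show "y * v = v * y" if "y * z = z * y" for y
      by (rule comm) (simp add: that algebra_simps)
  qed
qed

lemma norm_minus_square_le:
  fixes h :: "'a::cstar_algebra"
  assumes h: "star h = h" and le: "norm h \<le> t"
  shows "norm (t\<^sup>2 *\<^sub>R 1 - h * h) \<le> t\<^sup>2"
proof (cases "t = 0")
  case True
  with le show ?thesis by simp
next
  case False
  then have t: "0 < t" using le norm_ge_zero[of h] by linarith
  have "norm (1 - ((1/t) *\<^sub>R h) * ((1/t) *\<^sub>R h)) \<le> 1"
    by (rule norm_one_minus_square_le) (use h le t in simp_all)
  then have "t\<^sup>2 * norm (1 - ((1/t) *\<^sub>R h) * ((1/t) *\<^sub>R h)) \<le> t\<^sup>2 * 1"
    by (intro mult_left_mono) simp_all
  also have "t\<^sup>2 * norm (1 - ((1/t) *\<^sub>R h) * ((1/t) *\<^sub>R h)) =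
      norm (t\<^sup>2 *\<^sub>R (1 - ((1/t) *\<^sub>R h) * ((1/t) *\<^sub>R h)))" by simp
  also have "t\<^sup>2 *\<^sub>R (1 - ((1/t) *\<^sub>R h) * ((1/t) *\<^sub>R h)) = t\<^sup>2 *\<^sub>R 1 - h * h"
    using t by (simp add: scaleR_diff_right power2_eq_square)
  finally show ?thesis by simp
qed

text \<open>
  Here \<open>q\<close> is a square root of the absolute value of \<open>b\<close>: after scaling \<open>b\<close> to norm 1, the square
  root of \<open>b\<^sup>2\<close> is again at distance at most 1 from 1, and so has a square root itself.
\<close>

lemma ex_sqrt_abs:
  fixes b :: "'a::cstar_algebra"
  assumes b: "star b = b"
  obtains q where "star q = q" "(q * q) * (q * q) = b * b" "\<And>z. z * b = b * z \<Longrightarrow> z * q = q * z"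
proof (cases "b = 0")
  case True
  show ?thesis by (rule that[of 0]) (simp_all add: True)
next
  case False
  define t where "t = norm b"
  have t: "0 < t" using False by (simp add: t_def)
  define c where "c = (1/t) *\<^sub>R b"
  have c: "star c = c" "norm c \<le> 1" using t by (simp_all add: c_def b t_def)
  have s: "star (c * c) = c * c" by (simp add: star_mult c)
  obtain p where p: "star p = p" "p * p = c * c" "norm (1 - p) \<le> 1"
    and pc: "\<And>z. z * (c * c) = (c * c) * z \<Longrightarrow> z * p = p * z"
    by (rule ex_sqrt_near_one[OF s norm_one_minus_square_le[OF c]]) blast
  obtain q where q: "star q = q" "q * q = p" "norm (1 - q) \<le> 1"
    and qc: "\<And>z. z * p = p * z \<Longrightarrow> z * q = q * z"
    by (rule ex_sqrt_near_one[OF p(1,3)]) blast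
  show ?thesis
  proof (rule that[of "sqrt t *\<^sub>R q"])
    have "(sqrt t *\<^sub>R q * sqrt t *\<^sub>R q) * (sqrt t *\<^sub>R q * sqrt t *\<^sub>R q) = (t * t) *\<^sub>R (c * c)"
      using t by (simp add: q(2) p(2))
    also have "\<dots> = b * b" using t by (simp add: c_def)
    finally show "(sqrt t *\<^sub>R q * sqrt t *\<^sub>R q) * (sqrt t *\<^sub>R q * sqrt t *\<^sub>R q) = b * b" .
    fix z assume "z * b = b * z"
    then have "z * c = c * z" by (simp add: c_def)
    then have "z * (c * c) = (c * c) * z" by (metis mult.assoc)
    then show "z * (sqrt t *\<^sub>R q) = sqrt t *\<^sub>R q * z" using qc[OF pc, of z] by simp
  qed (simp add: q)
qed

section \<open>Positive elements of a commutative C*-algebra\<close>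

lemma positive_elem_sa: "positive_elem s \<Longrightarrow> star s = (s::'a::cstar_algebra)"
  by (auto simp: positive_elem_def star_mult star_star)

lemma positive_elem_star_mult [intro]: "positive_elem (star x * (x::'a::cstar_algebra))"
  by (auto simp: positive_elem_def)

lemma positive_elem_square: "star x = x \<Longrightarrow> positive_elem (x * (x::'a::cstar_algebra))"
  by (metis positive_elem_def)

lemma positive_elem_0 [simp]: "positive_elem (0::'a::cstar_algebra)"
  using positive_elem_square[of "0::'a"] by simp

lemma positive_elem_1 [simp]: "positive_elem (1::'a::cstar_algebra)"
  using positive_elem_square[of "1::'a"] by simp

lemma positive_elem_scaleR:
  assumes "positive_elem (s::'a::cstar_algebra)" "0 \<le> t" shows "positive_elem (t *\<^sub>R s)"
proof -
  obtain y where "s = star y * y" using assms by (auto simp: positive_elem_def)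
  then have "t *\<^sub>R s = star (sqrt t *\<^sub>R y) * (sqrt t *\<^sub>R y)" using assms(2) by simp
  then show ?thesis by (metis positive_elem_def)
qed

text \<open>
  The metric condition is visibly additive, which is why sums of positive elements are positive.
  In the commutative case \<open>star y * y\<close> is the sum of the squares of the real and imaginary parts of
  \<open>y\<close>, and both squares satisfy the condition.
\<close>
lemma positive_elem_iff_norm:
  fixes s :: "'b::comm_cstar_algebra"
  shows "positive_elem s \<longleftrightarrow> star s = s \<and> (\<exists>t. norm (t *\<^sub>R 1 - s) \<le> t)"
proof (intro iffI conjI)
  assume pos: "positive_elem s"
  then show "star s = s" by (rule positive_elem_sa)
  obtain y where y: "s = star y * y" using pos by (auto simp: positive_elem_def)
  obtain h k where hk: "star h = h" "star k = k" "y = h + scaleC \<i> k"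
    by (rule cartesian_decomposition)
  have "s = h * h + k * k"
    unfolding y hk(3) by (rule star_mult_cartesian) (simp_all add: hk mult.commute)
  then have "((norm h)\<^sup>2 + (norm k)\<^sup>2) *\<^sub>R 1 - s = ((norm h)\<^sup>2 *\<^sub>R 1 - h * h) + ((norm k)\<^sup>2 *\<^sub>R 1 - k * k)"
    by (simp add: scaleR_add_left)
  then have "norm (((norm h)\<^sup>2 + (norm k)\<^sup>2) *\<^sub>R 1 - s) \<le> (norm h)\<^sup>2 + (norm k)\<^sup>2"
    using norm_triangle_mono norm_minus_square_le[OF hk(1) order_refl] norm_minus_square_le[OF hk(2) order_refl]
    by metis
  then show "\<exists>t. norm (t *\<^sub>R 1 - s) \<le> t" by blast
next
  assume "star s = s \<and> (\<exists>t. norm (t *\<^sub>R 1 - s) \<le> t)"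
  then obtain t where "star s = s" "norm (t *\<^sub>R 1 - s) \<le> t" by blast
  then obtain k where "star k = k" "k * k = s" by (rule ex_sqrt) blast
  then show "positive_elem s" using positive_elem_square by blast
qed

lemma positive_elem_add:
  fixes s :: "'b::comm_cstar_algebra"
  assumes "positive_elem s" "positive_elem s'"
  shows "positive_elem (s + s')"
proof -
  obtain t t' where n: "norm (t *\<^sub>R 1 - s) \<le> t" "norm (t' *\<^sub>R 1 - s') \<le> t'"
    and sa: "star s = s" "star s' = s'"
    using assms by (auto simp: positive_elem_iff_norm)
  have "(t + t') *\<^sub>R 1 - (s + s') = (t *\<^sub>R 1 - s) + (t' *\<^sub>R 1 - s')" by (simp add: scaleR_add_left)
  then have "norm ((t + t') *\<^sub>R 1 - (s + s')) \<le> t + t'"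
    using norm_triangle_mono[OF n] by metis
  with sa show ?thesis unfolding positive_elem_iff_norm by (auto simp: star_add)
qed

lemma positive_elem_mult:
  fixes s :: "'b::comm_cstar_algebra"
  assumes "positive_elem s" "positive_elem s'"
  shows "positive_elem (s * s')"
proof -
  obtain y z where "s = star y * y" "s' = star z * z" using assms by (auto simp: positive_elem_def)
  then have "s * s' = star (y * z) * (y * z)" by (simp add: star_mult mult_ac)
  then show ?thesis by (metis positive_elem_def)
qed

text \<open>
  With \<open>M = norm q\<close>, both \<open>p\<close> and \<open>M - p\<close> are positive, hence so is \<open>p (M - p)\<close>; completing the
  square confines \<open>p\<close> to distance \<open>M/2\<close> from \<open>M/2\<close>.
\<close>
lemma norm_mono_positive:
  fixes p q :: "'b::comm_cstar_algebra"
  assumes p: "positive_elem p" and d: "positive_elem (q - p)"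
  shows "norm p \<le> norm q"
proof -
  let ?M = "norm q"
  have sp: "star p = p" and sq: "star q = q"
    using positive_elem_sa[OF p] positive_elem_sa[OF d] by (simp_all add: star_diff)
  obtain v where "star v = v" "v * v = ?M *\<^sub>R 1 - q"
    by (rule ex_sqrt_norm_minus[OF sq order_refl]) blast
  then have "positive_elem (?M *\<^sub>R 1 - q)" using positive_elem_square by metis
  from positive_elem_add[OF this d] have "positive_elem (?M *\<^sub>R 1 - p)" by simp
  then have "positive_elem (p * (?M *\<^sub>R 1 - p))" by (rule positive_elem_mult[OF p])
  then obtain t where "star (p * (?M *\<^sub>R 1 - p)) = p * (?M *\<^sub>R 1 - p)"
    "norm (t *\<^sub>R 1 - p * (?M *\<^sub>R 1 - p)) \<le> t" by (auto simp: positive_elem_iff_norm)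
  then obtain k where k: "star k = k" "k * k = p * (?M *\<^sub>R 1 - p)" by (rule ex_sqrt) blast
  \<comment> \<open>since \<open>p (M - p) + (p - M/2)\<^sup>2 = (M/2)\<^sup>2\<close> with \<open>p (M - p) = k\<^sup>2\<close>\<close>
  have "norm (p - (?M/2) *\<^sub>R 1) \<le> ?M/2"
  proof (rule norm_le_of_sum_squares(1)[OF _ k(1)])
    have "p * (?M *\<^sub>R 1 - p) = ?M *\<^sub>R p - p * p" by (simp add: algebra_simps)
    also have "?M *\<^sub>R p = (?M/2) *\<^sub>R p + (?M/2) *\<^sub>R p" by (simp flip: scaleR_add_left)
    finally have kk: "k * k = (?M/2) *\<^sub>R p + (?M/2) *\<^sub>R p - p * p" unfolding k(2) .
    have "(p - (?M/2) *\<^sub>R 1) * (p - (?M/2) *\<^sub>R 1) =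
        p * p - (?M/2) *\<^sub>R p - (?M/2) *\<^sub>R p + (?M/2)\<^sup>2 *\<^sub>R 1"
      by (simp add: algebra_simps power2_eq_square)
    then show "(p - (?M/2) *\<^sub>R 1) * (p - (?M/2) *\<^sub>R 1) + k * k = (?M/2)\<^sup>2 *\<^sub>R 1"
      unfolding kk by simp
  qed (simp_all add: star_diff sp mult.commute)
  then have "norm (p - (?M/2) *\<^sub>R 1) + norm ((?M/2) *\<^sub>R (1::'b)) \<le> ?M" by simp
  with norm_triangle_ineq[of "p - (?M/2) *\<^sub>R 1" "(?M/2) *\<^sub>R 1"] show ?thesis by simp
qed

section \<open>Recovering the norm from the moments under a faithful expectation\<close>

locale comm_cstar_ncps = cstar_ncps emb E
  for emb :: "'b::comm_cstar_algebra \<Rightarrow> 'a::cstar_algebra" and E :: "'a \<Rightarrow> 'b"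
begin

lemma E_scaleR: "E (t *\<^sub>R x) = t *\<^sub>R E x"
  by (simp add: scaleR_scaleC E_scaleC)

lemma E_diff: "E (x - y) = E x - E y"
  using E_add[of x "- y"] E_scaleR[of "-1" y] by simp

lemma norm_E_square_le:
  assumes "star z = z"
  shows "norm (E (z * z)) \<le> (norm z)\<^sup>2"
proof -
  have "star (z * z) = z * z" "norm (z * z) \<le> (norm z)\<^sup>2"
    by (simp_all add: star_mult assms norm_square_sa)
  then obtain v where v: "star v = v" "v * v = (norm z)\<^sup>2 *\<^sub>R 1 - z * z"
    by (rule ex_sqrt_norm_minus) blast
  have "positive_elem (E (z * z))" "positive_elem (E (v * v))"
    using E_positive[of z] E_positive[of v] by (simp_all add: assms v(1))
  then have "norm (E (z * z)) \<le> norm ((norm z)\<^sup>2 *\<^sub>R (1::'b))"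
    by (intro norm_mono_positive) (simp_all add: v(2) E_diff E_scaleR E_one)
  then show ?thesis by simp
qed

text \<open>
  Faithfulness of \<open>E\<close> turns the norm into a growth rate of moments.  If \<open>h\<^sup>2\<close> exceeded \<open>s\<^sup>2 > M\<^sup>2\<close>
  somewhere, twice the positive part of \<open>h\<^sup>2 - s\<^sup>2\<close>, called \<open>u\<close>, would be nonzero, and
  \<open>s ^ (2 k) E(u\<^sup>2) \<le> E(u h ^ (2 k) u) \<le> norm u ^ 2 E(h ^ (2 k))\<close> would contradict the growth bound for
  large \<open>k\<close>, as \<open>E(u\<^sup>2) \<noteq> 0\<close>.
\<close>
lemma norm_le_of_even_moments:
  assumes faithful: "faithful_expectation E"
    and h: "star h = h" and M: "0 \<le> M"
    and moments: "\<And>k. norm (E (h ^ (2 * k))) \<le> M ^ (2 * k)"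
  shows "norm h \<le> M"
proof (rule dense_ge)
  fix s assume "M < s"
  with M have s: "0 < s" by simp
  define b where "b = h * h - s\<^sup>2 *\<^sub>R 1"
  have b: "star b = b" "h * b = b * h" by (simp_all add: b_def star_diff star_mult h algebra_simps)
  obtain q where q: "star q = q" "(q * q) * (q * q) = b * b"
    and q_comm: "\<And>z. z * b = b * z \<Longrightarrow> z * q = q * z"
    by (rule ex_sqrt_abs[OF b(1)]) blast
  have hq: "h * q = q * h" and bq: "b * q = q * b" by (rule q_comm, simp add: b)+
  \<comment> \<open>\<open>q\<^sup>2\<close> is the absolute value of \<open>b\<close>, so \<open>u\<close> is twice the positive part of \<open>b\<close>\<close>
  define u where "u = q * q + b"
  have hqq: "h * (q * q) = (q * q) * h" and bqq: "b * (q * q) = (q * q) * b"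
    using hq bq by (metis mult.assoc)+
  have u: "star u = u" "h * u = u * h" "q * u = u * q"
    by (simp_all add: u_def star_add star_mult q b algebra_simps hqq hq bq mult.assoc)
  have bu: "b * u = (q * q) * u"
    by (simp add: u_def distrib_left bqq q(2))
  \<comment> \<open>on the support of \<open>u\<close> one has \<open>h\<^sup>2 \<ge> s\<^sup>2\<close>, which bounds the moments weighted by \<open>u\<close> below\<close>
  have lower: "positive_elem (E (u * h ^ (2 * k) * u) - s ^ (2 * k) *\<^sub>R E (u * u))" for k
  proof (induction k)
    case (Suc k)
    define H where "H = h ^ k"
    have H: "star H = H" "H * q = q * H" "h ^ (2 * k) = H * H"
      using power_commuting_commutes[OF hq, of k]
      by (simp_all add: H_def star_power h mult_2 power_add)
    have "h ^ (2 * Suc k) = h ^ (2 * k + 2)" by simp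
    also have "\<dots> = H * H * (h * h)" by (simp only: power_add H(3) power2_eq_square)
    finally have hh: "h ^ (2 * Suc k) = H * H * (b + s\<^sup>2 *\<^sub>R 1)" by (simp add: b_def)
    have "u * (H * H) * (b * u) = u * (H * H) * (q * (q * u))"
      unfolding bu by (simp add: mult.assoc)
    also have "\<dots> = u * q * H * (H * (q * u))"
      by (metis H(2) mult.assoc)
    also have "\<dots> = star (H * (q * u)) * (H * (q * u))"
      by (simp add: star_mult H(1) q(1) u(1))
    finally have "positive_elem (E (u * (H * H) * (b * u)))" by (simp add: E_positive)
    moreover have "u * h ^ (2 * Suc k) * u = u * (H * H) * (b * u) + s\<^sup>2 *\<^sub>R (u * h ^ (2 * k) * u)"
      unfolding hh H(3) by (simp add: algebra_simps)
    then have "E (u * h ^ (2 * Suc k) * u) - s ^ (2 * Suc k) *\<^sub>R E (u * u) =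
      E (u * (H * H) * (b * u)) + s\<^sup>2 *\<^sub>R (E (u * h ^ (2 * k) * u) - s ^ (2 * k) *\<^sub>R E (u * u))"
      by (simp add: E_add E_scaleR algebra_simps power2_eq_square)
    ultimately show ?case
      by (simp only:) (intro positive_elem_add positive_elem_scaleR Suc.IH, simp_all)
  qed simp
  have upper: "positive_elem ((norm u)\<^sup>2 *\<^sub>R E (h ^ (2 * k)) - E (u * h ^ (2 * k) * u))" for k
  proof -
    have "star (u * u) = u * u" "norm (u * u) \<le> (norm u)\<^sup>2"
      by (simp_all add: star_mult u norm_square_sa)
    then obtain v where v: "star v = v" "v * v = (norm u)\<^sup>2 *\<^sub>R 1 - u * u"
      by (rule ex_sqrt_norm_minus) blast
    define H where "H = h ^ k"
    have H: "star H = H" "H * u = u * H" "h ^ (2 * k) = H * H"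
      using power_commuting_commutes[OF u(2), of k]
      by (simp_all add: H_def star_power h mult_2 power_add)
    have "star (v * H) * (v * H) = H * (v * v) * H"
      by (simp add: star_mult v(1) H(1) mult.assoc)
    also have "\<dots> = (norm u)\<^sup>2 *\<^sub>R (H * H) - (H * u) * (u * H)"
      by (simp add: v(2) algebra_simps)
    also have "(H * u) * (u * H) = u * h ^ (2 * k) * u"
      unfolding H(3) by (metis H(2) mult.assoc)
    finally show ?thesis
      using E_positive[of "v * H"] by (simp add: E_diff E_scaleR H(3))
  qed
  have bound: "norm (E (u * u)) \<le> (norm u)\<^sup>2 * (M / s) ^ (2 * k)" for k
  proof -
    have "positive_elem (E (u * u))" using E_positive[of u] by (simp add: u)
    then have "positive_elem (s ^ (2 * k) *\<^sub>R E (u * u))"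
      by (rule positive_elem_scaleR) simp
    moreover have "positive_elem ((norm u)\<^sup>2 *\<^sub>R E (h ^ (2 * k)) - s ^ (2 * k) *\<^sub>R E (u * u))"
      using positive_elem_add[OF upper[of k] lower[of k]] by simp
    ultimately have "norm (s ^ (2 * k) *\<^sub>R E (u * u)) \<le> norm ((norm u)\<^sup>2 *\<^sub>R E (h ^ (2 * k)))"
      by (rule norm_mono_positive)
    also have "\<dots> \<le> (norm u)\<^sup>2 * M ^ (2 * k)"
      using moments[of k] by (simp add: mult_left_mono)
    finally show ?thesis using s by (simp add: power_divide field_simps)
  qed
  have "(M / s)\<^sup>2 < 1" using \<open>M < s\<close> M s by (simp add: power_less_one_iff)
  then have "(\<lambda>k. (norm u)\<^sup>2 * ((M / s)\<^sup>2) ^ k) \<longlonglongrightarrow> (norm u)\<^sup>2 * 0"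
    by (intro tendsto_mult tendsto_const LIMSEQ_power_zero) simp
  then have "norm (E (u * u)) \<le> (norm u)\<^sup>2 * 0"
    by (rule LIMSEQ_le_const) (use bound in \<open>simp add: power_mult\<close>)
  then have "u = 0" using faithful u(1) by (auto simp: faithful_expectation_def)
  \<comment> \<open>\<open>b\<close> has no positive part, so \<open>s\<^sup>2 - h\<^sup>2\<close> is the square of \<open>q\<close>\<close>
  then have "h * h + q * q = s\<^sup>2 *\<^sub>R 1" by (simp add: u_def b_def algebra_simps)
  then show "norm h \<le> s" using norm_le_of_sum_squares(1)[OF h q(1) hq] s by simp
qed

end

section \<open>Domination in a commutative C*-algebra\<close>

text \<open>
  For functions, \<open>p\<close> dominating \<open>b\<close> means \<open>\<bar>b\<bar> \<le> p\<close> pointwise.  The definition asks for more, namely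
  a finite decomposition \<open>p = \<Sum>i. s\<^sub>i\<close>, \<open>b = \<Sum>i. z\<^sub>i s\<^sub>i\<close> with \<open>s\<^sub>i\<close> positive and \<open>z\<^sub>i\<close> in the closed unit disc.
  In this form sums, products and all positive linear maps preserve domination for trivial reasons,
  whereas \<open>\<bar>F b\<bar> \<le> F p\<close> for a positive map \<open>F\<close> would otherwise need complete positivity or a
  functional representation of the algebra.
\<close>
inductive dominates :: "'b::comm_cstar_algebra \<Rightarrow> 'b \<Rightarrow> bool" where
  dominates_base: "positive_elem s \<Longrightarrow> cmod z \<le> 1 \<Longrightarrow> dominates s (scaleC z s)"
| dominates_add: "dominates p b \<Longrightarrow> dominates q c \<Longrightarrow> dominates (p + q) (b + c)"

lemma dominates_zero: "positive_elem p \<Longrightarrow> dominates p 0"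
  using dominates_base[of p 0] by simp

lemma dominates_self: "positive_elem p \<Longrightarrow> dominates p p"
  using dominates_base[of p 1] by (simp add: scaleC_one)

lemma dominates_sum:
  "(\<And>i. i \<in> I \<Longrightarrow> dominates (p i) (b i)) \<Longrightarrow> dominates (sum p I) (sum b I)"
  by (induction I rule: infinite_finite_induct) (simp_all add: dominates_zero dominates_add)

lemma dominates_positive_map:
  assumes "dominates p b"
    and add: "\<And>x y. F (x + y) = F x + F y" and scaleC: "\<And>z x. F (scaleC z x) = scaleC z (F x)"
    and pos: "\<And>s. positive_elem s \<Longrightarrow> positive_elem (F s)"
  shows "dominates (F p) (F b)"
  using assms(1) by induction (simp_all add: add scaleC pos dominates.intros)

lemma dominates_scaleC:
  assumes "dominates p b" "cmod z \<le> 1" shows "dominates p (scaleC z b)"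
  using assms(1)
proof induction
  case (dominates_base s w)
  have "cmod (z * w) \<le> 1" using assms(2) dominates_base(2) by (simp add: norm_mult mult_le_one)
  then show ?case using dominates_base(1) by (simp add: scaleC_scaleC dominates.dominates_base)
qed (simp add: scaleC_add_right dominates_add)

lemma dominates_scaleR:
  assumes "dominates p b" "0 \<le> t" shows "dominates (t *\<^sub>R p) (t *\<^sub>R b)"
  by (rule dominates_positive_map[OF assms(1)])
    (use assms(2) in \<open>simp_all add: scaleC_add_right scaleR_scaleC scaleC_scaleC mult.commute positive_elem_scaleR[unfolded scaleR_scaleC]\<close>)

lemma dominates_star:
  assumes "dominates p b" shows "dominates p (star b)"
  using assms
  by induction (simp_all add: star_add dominates_add star_scaleC positive_elem_sa dominates_base)

lemma dominates_mult_positive: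
  assumes "dominates p b" "positive_elem s" shows "dominates (p * s) (b * s)"
  by (rule dominates_positive_map[OF assms(1)])
    (simp_all add: assms(2) distrib_right mult_scaleC_left positive_elem_mult)

lemma dominates_mult:
  assumes "dominates p b" "dominates q c" shows "dominates (p * q) (b * c)"
  using assms(2)
proof induction
  case (dominates_base s z)
  from dominates_scaleC[OF dominates_mult_positive[OF assms(1) this(1)] this(2)]
  show ?case by (simp add: mult_scaleC_right)
qed (simp add: distrib_left dominates_add)

text \<open>
  The polarised form of \<open>\<bar>b\<bar>\<^sup>2 \<le> p\<^sup>2\<close>, that is \<open>Re (star b * c) \<le> p * q\<close>.  Being bilinear, it reduces to
  single terms \<open>b = z s\<close>, \<open>c = w t\<close>, where it says \<open>Re (cnj z * w) \<le> 1\<close>.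
\<close>
lemma dominates_cross_term:
  assumes "dominates p b" "dominates q c"
  shows "positive_elem (2 *\<^sub>R (p * q) - (star b * c + b * star c))"
  using assms(1)
proof induction
  case (dominates_base s z)
  note s = this
  from assms(2) show ?case
  proof induction
    case (dominates_base t w)
    have "2 *\<^sub>R (s * t) - (star (scaleC z s) * scaleC w t + scaleC z s * star (scaleC w t)) =
        scaleC (of_real 2 - (cnj z * w + z * cnj w)) (s * t)"
      using s(1) dominates_base(1)
      by (simp add: star_scaleC positive_elem_sa mult_scaleC_left mult_scaleC_right scaleC_scaleC
          scaleR_scaleC mult.commute scaleC_add_left scaleC_diff_left)
    also have "of_real 2 - (cnj z * w + z * cnj w) = of_real (2 - 2 * Re (cnj z * w))"
      by (simp add: complex_eq_iff)
    finally have eq: "2 *\<^sub>R (s * t) - (star (scaleC z s) * scaleC w t + scaleC z s * star (scaleC w t)) =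
        (2 - 2 * Re (cnj z * w)) *\<^sub>R (s * t)" by (simp only: scaleR_scaleC)
    have "Re (cnj z * w) \<le> 1"
      using complex_Re_le_cmod[of "cnj z * w"] mult_le_one[OF s(2) norm_ge_zero dominates_base(2)]
      by (simp add: norm_mult)
    then show ?case
      unfolding eq by (intro positive_elem_scaleR positive_elem_mult s dominates_base) simp
  next
    case (dominates_add p1 b1 p2 b2)
    have "2 *\<^sub>R (s * (p1 + p2)) - (star (scaleC z s) * (b1 + b2) + scaleC z s * star (b1 + b2)) =
       (2 *\<^sub>R (s * p1) - (star (scaleC z s) * b1 + scaleC z s * star b1)) +
       (2 *\<^sub>R (s * p2) - (star (scaleC z s) * b2 + scaleC z s * star b2))"
      by (simp add: algebra_simps star_add)
    with positive_elem_add[OF dominates_add.IH] show ?case by (simp only:)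
  qed
next
  case (dominates_add p1 b1 p2 b2)
  have "2 *\<^sub>R ((p1 + p2) * q) - (star (b1 + b2) * c + (b1 + b2) * star c) =
     (2 *\<^sub>R (p1 * q) - (star b1 * c + b1 * star c)) +
     (2 *\<^sub>R (p2 * q) - (star b2 * c + b2 * star c))"
    by (simp add: algebra_simps star_add)
  with positive_elem_add[OF dominates_add.IH] show ?case by (simp only:)
qed

lemma dominates_positive: "dominates p b \<Longrightarrow> positive_elem p"
  by (induction rule: dominates.induct) (simp_all add: positive_elem_add)

lemma dominates_norm_le:
  assumes "dominates p b" shows "norm b \<le> norm p"
proof -
  have "star b * b + b * star b = 2 *\<^sub>R (star b * b)"
    by (simp add: scaleR_2 mult.commute)
  then have "positive_elem (2 *\<^sub>R (p * p) - 2 *\<^sub>R (star b * b))"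
    using dominates_cross_term[OF assms assms] by simp
  moreover have "positive_elem (2 *\<^sub>R (star b * b))" by (intro positive_elem_scaleR) auto
  ultimately have "norm (2 *\<^sub>R (star b * b)) \<le> norm (2 *\<^sub>R (p * p))" by (intro norm_mono_positive)
  moreover have "norm (p * p) = (norm p)\<^sup>2"
    by (intro norm_square_sa positive_elem_sa dominates_positive[OF assms])
  ultimately show ?thesis by (simp add: cstar_identity)
qed

lemma dominates_norm_sa:
  assumes h: "star h = h" shows "dominates (norm h *\<^sub>R 1) h"
proof -
  have pos: "positive_elem (norm h *\<^sub>R 1 - x)" if "star x = x" "norm x \<le> norm h" for x :: 'a
    using that by (auto simp: positive_elem_iff_norm star_diff intro!: exI[of _ "norm h"])
  have "dominates ((1/2) *\<^sub>R (norm h *\<^sub>R 1 - (- h)) + (1/2) *\<^sub>R (norm h *\<^sub>R 1 - h))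
      (scaleC 1 ((1/2) *\<^sub>R (norm h *\<^sub>R 1 - (- h))) + scaleC (-1) ((1/2) *\<^sub>R (norm h *\<^sub>R 1 - h)))"
    by (intro dominates.intros positive_elem_scaleR pos) (simp_all add: h)
  moreover have "(1/2) *\<^sub>R (x - (- y)) + (1/2) *\<^sub>R (x - y) = x"
    "scaleC 1 ((1/2) *\<^sub>R (x - (- y))) + scaleC (-1) ((1/2) *\<^sub>R (x - y)) = y" for x y :: 'a
    unfolding scaleC_minus_left scaleC_one add_uminus_conv_diff
    by (simp_all flip: scaleR_add_right scaleR_diff_right scaleR_2)
  ultimately show ?thesis by simp
qed

text \<open>
  A crude bound, obtained from the real and imaginary parts separately.  It serves only to absorb
  small error terms.
\<close>
lemma dominates_two_norm: "dominates ((2 * norm x) *\<^sub>R 1) x"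
proof -
  obtain h k where hk: "star h = h" "star k = k" "x = h + scaleC \<i> k"
    by (rule cartesian_decomposition)
  define r where "r = 2 * norm x - norm h - norm k"
  have r: "0 \<le> r" using norm_cartesian[OF hk(1,2)] by (simp add: hk(3) r_def)
  have "dominates (norm h *\<^sub>R 1 + norm k *\<^sub>R 1 + r *\<^sub>R 1) (h + scaleC \<i> k + 0)"
    by (intro dominates_add dominates_norm_sa dominates_scaleC dominates_zero positive_elem_scaleR hk r)
      simp_all
  then show ?thesis by (simp add: hk(3) r_def flip: scaleR_add_left)
qed

lemma sum_cis_eq:
  fixes m :: int
  assumes "N > 0"
  shows "(\<Sum>k<N. cis (2 * pi * real k * of_int m / real N)) = (if int N dvd m then of_nat N else 0)"
proof -
  define w where "w = cis (2 * pi * of_int m / real N)"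
  have w: "cis (2 * pi * real k * of_int m / real N) = w ^ k" for k
    by (simp add: w_def Complex.DeMoivre mult_ac)
  have "w ^ N = 1"
    using assms cis_multiple_2pi[of "of_int m"] by (simp add: w_def Complex.DeMoivre mult.assoc)
  have "w = 1 \<longleftrightarrow> int N dvd m"
  proof
    assume "w = 1"
    then have "cos (2 * pi * of_int m / real N) = 1" by (simp add: w_def complex_eq_iff)
    then obtain n :: int where "2 * pi * of_int m / real N = of_int n * 2 * pi"
      using cos_one_2pi_int by blast
    then have "of_int m = (of_int (n * int N) :: real)" using assms by (simp add: field_simps)
    then have "m = n * int N" by linarith
    then show "int N dvd m" by simp
  next
    assume "int N dvd m"
    then obtain n where "m = int N * n" by blast
    then show "w = 1" using assms cis_multiple_2pi[of "of_int n"] by (simp add: w_def mult.assoc)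
  qed
  then show ?thesis
    using \<open>w ^ N = 1\<close> by (cases "w = 1") (simp_all add: w geometric_sum)
qed

text \<open>
  A discrete Poisson formula.  With \<open>N = m + 1\<close> and \<open>\<omega>\<close> running through the \<open>N\<close>-th roots of unity, the
  elements \<open>s\<^sub>\<omega> = (1 - star b * b) * star y * y / N\<close> with \<open>y = (\<Sum>j<N. (cnj \<omega> * b) ^ j)\<close> are positive;
  up to the truncation of the geometric series \<open>y\<close> they are the Poisson kernel at \<open>b\<close>.
  Orthogonality of the characters gives \<open>\<Sum>\<omega>. s\<^sub>\<omega> = 1 - (star b * b) ^ N\<close>, and \<open>\<Sum>\<omega>. \<omega> s\<^sub>\<omega>\<close> is the
  dominated element of the conclusion, which is close to \<open>b\<close> when \<open>norm b < 1\<close> and \<open>m\<close> is large.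
  The sharp constant 1 is essential: a constant factor lost at every letter would survive in the
  growth rate of the moments.
\<close>
lemma dominates_Poisson_kernel:
  fixes b :: "'b::comm_cstar_algebra"
  assumes "norm b \<le> 1" "1 \<le> m"
  shows "dominates 1 (b * (1 - (star b * b) ^ m) + (1 - star b * b) * star b ^ m)"
proof -
  define N where "N = Suc m"
  have N: "N > 0" by (simp add: N_def)
  have dvd_small: "int N dvd x \<longleftrightarrow> x = 0" if "\<bar>x\<bar> < int N" for x
    using that dvd_imp_le_int[of x "int N"] by auto
  define c where "c k i = cis (2 * pi * real k * real i / real N)" for k i
  define X where "X i j = star b ^ i * b ^ j" for i j
  define y where "y k = (\<Sum>j<N. scaleC (cnj (c k j)) (b ^ j))" for k
  define s where "s k = (1 / real N) *\<^sub>R ((star (y k) * y k) * (1 - star b * b))" for k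
  have star_sum: "star (sum f I) = (\<Sum>i\<in>I. star (f i))" for f :: "nat \<Rightarrow> 'b" and I
    by (induction I rule: infinite_finite_induct) (simp_all add: star_add)
  have "star (star b * b) = star b * b" "norm (star b * b) \<le> 1"
    using assms(1) by (simp_all add: star_mult star_star cstar_identity power_le_one)
  then obtain v where "star v = v" "v * v = 1 *\<^sub>R 1 - star b * b"
    by (rule ex_sqrt_norm_minus) blast
  then have pos: "positive_elem (1 - star b * b)" using positive_elem_square[of v] by simp
  have s: "positive_elem (s k)" for k
    unfolding s_def by (intro positive_elem_scaleR positive_elem_mult positive_elem_star_mult pos) simp
  have yy: "star (y k) * y k = (\<Sum>i<N. \<Sum>j<N. scaleC (c k i * cnj (c k j)) (X i j))" for k
    by (simp add: y_def star_sum sum_product star_scaleC star_power X_def mult_scaleC_left mult_scaleC_right scaleC_scaleC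
        mult.commute[of "cnj _"])
  \<comment> \<open>averaging against a character of the \<open>N\<close>-th roots of unity extracts one residue class\<close>
  have average: "(\<Sum>k<N. scaleC (c k d) (s k)) =
      (\<Sum>i<N. \<Sum>j<N. if int N dvd int i - int j + int d then X i j else 0) * (1 - star b * b)" for d
  proof -
    have cc: "c k d * (c k i * cnj (c k j)) =
        cis (2 * pi * real k * of_int (int i - int j + int d) / real N)" for k i j
      by (simp add: c_def cis_mult cis_cnj algebra_simps add_divide_distrib diff_divide_distrib)
    have "(\<Sum>k<N. scaleC (c k d) (star (y k) * y k)) =
        (\<Sum>k<N. \<Sum>i<N. \<Sum>j<N. scaleC (c k d * (c k i * cnj (c k j))) (X i j))"
      by (simp add: yy scaleC_sum_right scaleC_scaleC)
    also have "\<dots> = (\<Sum>i<N. \<Sum>j<N. \<Sum>k<N. scaleC (c k d * (c k i * cnj (c k j))) (X i j))"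
      by (rule trans[OF sum.swap sum.cong[OF refl sum.swap]])
    also have "\<dots> = (\<Sum>i<N. \<Sum>j<N. if int N dvd int i - int j + int d then real N *\<^sub>R X i j else 0)"
      unfolding cc scaleC_sum_left[symmetric] sum_cis_eq[OF N]
      by (intro sum.cong refl) (simp add: scaleR_scaleC)
    also have "\<dots> = real N *\<^sub>R (\<Sum>i<N. \<Sum>j<N. if int N dvd int i - int j + int d then X i j else 0)"
      unfolding scaleR_sum_right by (intro sum.cong refl) simp
    finally have *: "(\<Sum>k<N. scaleC (c k d) (star (y k) * y k)) = \<dots>" .
    have "(\<Sum>k<N. scaleC (c k d) (s k)) =
        (1 / real N) *\<^sub>R ((\<Sum>k<N. scaleC (c k d) (star (y k) * y k)) * (1 - star b * b))"
      by (simp add: s_def scaleR_scaleC scaleC_scaleC mult_scaleC_left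
        sum_distrib_right scaleC_sum_right mult.commute[of "c _ _"])
    then show ?thesis unfolding * using N by simp
  qed
  have "(\<Sum>k<N. s k) = (\<Sum>i<N. \<Sum>j<N. if int N dvd int i - int j then X i j else 0) * (1 - star b * b)"
    using average[of 0] by (simp add: c_def scaleC_one)
  also have "(\<Sum>i<N. \<Sum>j<N. if int N dvd int i - int j then X i j else 0) = (\<Sum>i<N. X i i)"
  proof (intro sum.cong refl)
    fix i assume "i \<in> {..<N}"
    then have "int N dvd int i - int j \<longleftrightarrow> i = j" if "j < N" for j
      using that dvd_small[of "int i - int j"] by auto
    then have "(\<Sum>j<N. if int N dvd int i - int j then X i j else 0) = (\<Sum>j<N. if i = j then X i j else 0)"
      by (intro sum.cong) auto
    with \<open>i \<in> {..<N}\<close> show "(\<Sum>j<N. if int N dvd int i - int j then X i j else 0) = X i i" by simp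
  qed
  also have "\<dots> * (1 - star b * b) = 1 - (star b * b) ^ N"
    by (simp add: X_def one_diff_power_eq mult.commute flip: power_mult_distrib)
  finally have s_sum: "(\<Sum>k<N. s k) = 1 - (star b * b) ^ N" .
  have "(\<Sum>k<N. scaleC (c k 1) (s k)) =
      (\<Sum>i<N. \<Sum>j<N. if int N dvd int i - int j + 1 then X i j else 0) * (1 - star b * b)"
    using average[of 1] by simp
  also have "(\<Sum>i<N. \<Sum>j<N. if int N dvd int i - int j + 1 then X i j else 0) =
      (\<Sum>i<m. X i (Suc i)) + X m 0"
  proof -
    have "(\<Sum>j<N. if int N dvd int i - int j + 1 then X i j else 0) = X i (Suc i)" if "i < m" for i
    proof -
      have "int N dvd int i - int j + 1 \<longleftrightarrow> Suc i = j" if "j < N" for j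
        using that \<open>i < m\<close> dvd_small[of "int i - int j + 1"] by (auto simp: N_def)
      then have "(\<Sum>j<N. if int N dvd int i - int j + 1 then X i j else 0) =
          (\<Sum>j<N. if Suc i = j then X i j else 0)" by (intro sum.cong) auto
      with that show ?thesis by (simp add: N_def)
    qed
    moreover have "(\<Sum>j<N. if int N dvd int m - int j + 1 then X m j else 0) = X m 0"
    proof -
      have "int N dvd int m - int j + 1 \<longleftrightarrow> 0 = j" if "j < N" for j
        using that dvd_small[of "int m - int j + 1"] by (cases "j = 0") (auto simp: N_def add.commute)
      then have "(\<Sum>j<N. if int N dvd int m - int j + 1 then X m j else 0) =
          (\<Sum>j<N. if 0 = j then X m j else 0)" by (intro sum.cong) auto
      then show ?thesis by (simp add: N_def)
    qed
    ultimately show ?thesis by (simp add: N_def)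
  qed
  also have "(\<Sum>i<m. X i (Suc i)) = b * (\<Sum>i<m. (star b * b) ^ i)"
    by (simp add: X_def sum_distrib_left power_mult_distrib mult_ac)
  also have "(b * (\<Sum>i<m. (star b * b) ^ i) + X m 0) * (1 - star b * b) =
      b * (1 - (star b * b) ^ m) + (1 - star b * b) * star b ^ m"
    unfolding one_diff_power_eq[of "star b * b" m] by (simp add: X_def algebra_simps)
  finally have c_sum: "(\<Sum>k<N. scaleC (c k 1) (s k)) = \<dots>" .
  have "dominates (\<Sum>k<N. s k) (\<Sum>k<N. scaleC (c k 1) (s k))"
    by (intro dominates_sum dominates_base s) (simp add: c_def)
  moreover have "positive_elem ((star b * b) ^ N)"
    by (induction N) (auto intro: positive_elem_mult)
  ultimately have "dominates (1 - (star b * b) ^ N + (star b * b) ^ N)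
      (b * (1 - (star b * b) ^ m) + (1 - star b * b) * star b ^ m + 0)"
    unfolding s_sum c_sum by (intro dominates_add dominates_zero)
  then show ?thesis by simp
qed

lemma dominates_mono:
  assumes "dominates (t *\<^sub>R 1) b" "t \<le> r" shows "dominates (r *\<^sub>R 1) b"
proof -
  have "dominates (t *\<^sub>R 1 + (r - t) *\<^sub>R 1) (b + 0)"
    by (intro dominates_add assms(1) dominates_zero positive_elem_scaleR) (use assms(2) in simp_all)
  then show ?thesis by (simp flip: scaleR_add_left)
qed

lemma dominates_of_norm_less_1:
  assumes b: "norm b < 1" and r: "1 < r" shows "dominates (r *\<^sub>R 1) b"
proof -
  obtain m0 where m0: "norm b ^ m0 < (r - 1) / 6"
    using real_arch_pow_inv[of "(r - 1) / 6" "norm b"] b r by auto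
  define m where "m = Suc m0"
  have "norm b ^ m \<le> norm b ^ m0"
    unfolding m_def using b by (intro power_decreasing) simp_all
  with m0 have m: "norm b ^ m < (r - 1) / 6" by simp
  \<comment> \<open>the difference between \<open>b\<close> and the element that the Poisson kernel dominates\<close>
  define e where "e = b * (star b * b) ^ m - (1 - star b * b) * star b ^ m"
  have bb: "norm (star b * b) \<le> 1" using b by (simp add: cstar_identity power_le_one)
  have "norm (b * (star b * b) ^ m) = norm ((b * star b ^ m) * b ^ m)"
    by (simp add: power_mult_distrib mult.assoc)
  also have "\<dots> \<le> (norm b * norm (star b) ^ m) * norm b ^ m"
    by (intro norm_mult_ineq[THEN order_trans] mult_mono norm_power_ineq mult_nonneg_nonneg) simp_all
  also have "\<dots> \<le> 1 * norm b ^ m"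
    using b by (intro mult_right_mono mult_le_one) (simp_all add: power_le_one)
  finally have e1: "norm (b * (star b * b) ^ m) \<le> norm b ^ m" by simp
  have "norm (1 - star b * b) \<le> 2" using norm_triangle_ineq4[of 1 "star b * b"] bb by simp
  then have "norm ((1 - star b * b) * star b ^ m) \<le> 2 * norm (star b) ^ m"
    by (intro norm_mult_ineq[THEN order_trans] mult_mono norm_power_ineq) simp_all
  with e1 have "norm e \<le> 3 * norm b ^ m"
    unfolding e_def using norm_triangle_ineq4[of "b * (star b * b) ^ m" "(1 - star b * b) * star b ^ m"]
    by simp
  with m have e: "1 + 2 * norm e \<le> r" by simp
  have "dominates (1 + (2 * norm e) *\<^sub>R 1)
      (b * (1 - (star b * b) ^ m) + (1 - star b * b) * star b ^ m + e)"
    by (intro dominates_add dominates_two_norm dominates_Poisson_kernel) (use b in \<open>simp_all add: m_def\<close>)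
  then have "dominates ((1 + 2 * norm e) *\<^sub>R 1) b"
    by (simp add: e_def scaleR_add_left algebra_simps)
  then show ?thesis using e by (rule dominates_mono)
qed

lemma dominates_of_norm_less:
  assumes b: "norm b < r" shows "dominates (r *\<^sub>R 1) b"
proof -
  obtain t where t: "norm b < t" "t < r" using b dense by blast
  then have t0: "0 < t" using norm_ge_zero[of b] by linarith
  have "dominates ((r / t) *\<^sub>R 1) ((1 / t) *\<^sub>R b)"
    using t t0 by (intro dominates_of_norm_less_1) simp_all
  from dominates_scaleR[OF this, of t] show ?thesis using t0 by simp
qed

section \<open>Domination of circular moments\<close>

context comm_cstar_ncps
begin

lemma dominates_alpha:
  assumes "dominates p b" shows "dominates (alpha T e p) (alpha T e b)"
proof (rule dominates_positive_map[OF assms])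
  show "alpha T e (x + y) = alpha T e x + alpha T e y" for x y
    by (cases e) (simp_all add: alpha_def emb_add E_add algebra_simps)
  show "alpha T e (scaleC z x) = scaleC z (alpha T e x)" for z x
    by (cases e) (simp_all add: alpha_def emb_scaleC E_scaleC mult_scaleC_left mult_scaleC_right)
  fix s :: 'b assume "positive_elem s"
  then obtain y where y: "s = star y * y" by (auto simp: positive_elem_def)
  have "alpha T e s = E (star (emb y * star (letter T e)) * (emb y * star (letter T e)))"
    by (cases e) (simp_all add: alpha_def y star_mult star_star emb_mult emb_star mult.assoc)
  then show "positive_elem (alpha T e s)" by (simp add: E_positive)
qed

definition letters_dominate :: "(exponent \<times> 'b) list \<Rightarrow> (exponent \<times> 'b) list \<Rightarrow> bool"
  where "letters_dominate = list_all2 (\<lambda>(e, p) (e', b). e = e' \<and> dominates p b)"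

text \<open>
  The recursion for the moments consists of sums, products and the positive maps \<open>alpha T e\<close>, all of
  which preserve domination, so the claim follows by induction on the length of the word.
\<close>
lemma dominates_moment:
  assumes T: "circular emb E T" and "letters_dominate v w"
  shows "dominates (E (prod_list (word T v))) (E (prod_list (word T w)))"
  using assms(2)
proof (induction w arbitrary: v rule: length_induct)
  case (1 w)
  have len: "length v = length w" using 1(2) by (simp add: letters_dominate_def list_all2_lengthD)
  show ?case
  proof (cases "w = []")
    case True
    with len show ?thesis by (simp add: word_def E_one dominates_self)
  next
    case False
    with len have ne: "v \<noteq> []" "w \<noteq> []" by auto
    have recursion: "E (prod_list (word T u)) = circ_moment T u" if "u \<noteq> []" for u
      using T that circular_iff_cumulants[of T] cumulants_iff_moments[of T] by blast
    have nth: "fst (v ! j) = fst (w ! j)" "dominates (snd (v ! j)) (snd (w ! j))" if "j < length w" for j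
      using list_all2_nthD2[OF 1(2)[unfolded letters_dominate_def] that] by (auto split: prod.splits)
    have sub: "letters_dominate (take i (tl v)) (take i (tl w))" "letters_dominate (drop i v) (drop i w)" for i
      using 1(2) ne unfolding letters_dominate_def
      by (auto simp: neq_Nil_conv intro!: list_all2_takeI list_all2_dropI)
    have "length (take i (tl w)) < length w" "length (drop (i + 1) w) < length w" for i
      using ne by (auto simp: neq_Nil_conv)
    with 1(1) sub have IH:
      "dominates (E (prod_list (word T (take i (tl v))))) (E (prod_list (word T (take i (tl w)))))"
      "dominates (E (prod_list (word T (drop (i + 1) v)))) (E (prod_list (word T (drop (i + 1) w))))" for i
      by blast+
    have head: "fst (v ! 0) = fst (w ! 0)" using nth(1)[of 0] ne by simp
    have index: "{j \<in> {1..<length v}. fst (v ! j) \<noteq> fst (w ! 0)} = {j \<in> {1..<length w}. fst (w ! j) \<noteq> fst (w ! 0)}"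
      using len ne nth by auto
    show ?thesis
      unfolding recursion[OF ne(1)] recursion[OF ne(2)] circ_moment_def head index
      by (intro dominates_sum dominates_mult dominates_alpha IH nth(2)) (use ne in auto)
  qed
qed

text \<open>
  The comparison of two monomials in \<open>T\<close>, \<open>star T\<close> and \<open>B\<close> with the same pattern of exponents,
  whose coefficients dominate each other position by position.  Coefficients are allowed at both
  ends, so that the relation is closed under products and adjoints; this gives access to
  \<open>(star x * x) ^ k\<close>.
\<close>
inductive monomial_dominates :: "'a \<Rightarrow> 'a \<Rightarrow> 'a \<Rightarrow> bool" for T where
  monomial_emb: "dominates p b \<Longrightarrow> monomial_dominates T (emb p) (emb b)"
| monomial_letter: "dominates p b \<Longrightarrow> monomial_dominates T y x \<Longrightarrow>
    monomial_dominates T (emb p * letter T e * y) (emb b * letter T e * x)"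

lemma monomial_dominates_expectation:
  assumes T: "circular emb E T" and "monomial_dominates T y x"
  shows "dominates (E y) (E x)"
proof -
  have "\<exists>p b v w. dominates p b \<and> letters_dominate v w \<and>
      y = emb p * prod_list (word T v) \<and> x = emb b * prod_list (word T w)"
    using assms(2)
  proof induction
    case (monomial_emb p b)
    then show ?case by (intro exI[of _ p] exI[of _ b] exI[of _ "[]"]) (simp add: letters_dominate_def word_def)
  next
    case (monomial_letter p b y x e)
    then obtain p' b' v w where "dominates p' b'" "letters_dominate v w"
      "y = emb p' * prod_list (word T v)" "x = emb b' * prod_list (word T w)" by blast
    with monomial_letter(1) show ?case
      by (intro exI[of _ p] exI[of _ b] exI[of _ "(e, p') # v"] exI[of _ "(e, b') # w"])
        (simp add: letters_dominate_def word_def mult.assoc)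
  qed
  then obtain p b v w where *: "dominates p b" "letters_dominate v w"
      "y = emb p * prod_list (word T v)" "x = emb b * prod_list (word T w)" by blast
  have "E (emb b * z) = b * E z" for b z using E_bimodule[of b z 1] by (simp add: emb_one)
  with * show ?thesis by (simp add: dominates_mult dominates_moment[OF T])
qed

lemma monomial_dominates_emb_mult:
  assumes "monomial_dominates T y x" "dominates q c"
  shows "monomial_dominates T (emb q * y) (emb c * x)"
  using assms(1)
proof cases
  case (monomial_emb p b)
  with assms(2) show ?thesis
    using monomial_dominates.monomial_emb[OF dominates_mult, of q c p b] by (simp add: emb_mult)
next
  case (monomial_letter p b y' x' e)
  with assms(2) show ?thesis
    using monomial_dominates.monomial_letter[OF dominates_mult, of q c p b] by (simp add: emb_mult mult.assoc)
qed

lemma monomial_dominates_mult: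
  assumes "monomial_dominates T y x" "monomial_dominates T y' x'"
  shows "monomial_dominates T (y * y') (x * x')"
  using assms(1)
proof induction
  case (monomial_emb p b)
  then show ?case by (rule monomial_dominates_emb_mult[OF assms(2)])
next
  case (monomial_letter p b y x e)
  from monomial_dominates.monomial_letter[OF monomial_letter(1,3), of e]
  show ?case by (simp add: mult.assoc)
qed

lemma monomial_dominates_one: "monomial_dominates T 1 1"
  using monomial_emb[OF dominates_self[OF positive_elem_1]] by (simp add: emb_one)

lemma monomial_dominates_letter: "monomial_dominates T (letter T e) (letter T e)"
  using monomial_letter[OF dominates_self[OF positive_elem_1] monomial_dominates_one, of T e]
  by (simp add: emb_one)

lemma monomial_dominates_power:
  "monomial_dominates T y x \<Longrightarrow> monomial_dominates T (y ^ n) (x ^ n)"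
  by (induction n) (simp_all add: monomial_dominates_one monomial_dominates_mult)

lemma monomial_dominates_star:
  assumes "monomial_dominates T y x" shows "monomial_dominates T (star y) (star x)"
  using assms
proof induction
  case (monomial_emb p b)
  from dominates_star[OF this] show ?case
    using monomial_dominates.monomial_emb[of p "star b" T] positive_elem_sa[OF dominates_positive[OF monomial_emb]]
    by (simp add: emb_star[symmetric])
next
  case (monomial_letter p b y x e)
  define e' where "e' = (case e of Plain \<Rightarrow> Adjoint | Adjoint \<Rightarrow> Plain)"
  have e': "star (letter T e) = letter T e'" by (cases e) (simp_all add: e'_def star_star)
  have "monomial_dominates T (star y * (letter T e' * emb p)) (star x * (letter T e' * emb (star b)))"
    by (intro monomial_dominates_mult monomial_letter(3) monomial_dominates_letter
        monomial_dominates.monomial_emb dominates_star monomial_letter(1))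
  then show ?case
    using positive_elem_sa[OF dominates_positive[OF monomial_letter(1)]]
    by (simp add: star_mult e' emb_star[symmetric] mult.assoc)
qed

text \<open>
  The moments of \<open>star x * x\<close> are dominated by those of \<open>star y * y\<close>, which grow at most like the
  powers of \<open>norm y ^ 2\<close>; by faithfulness this growth bounds \<open>star x * x\<close>.
\<close>
lemma monomial_dominates_norm_le:
  assumes faithful: "faithful_expectation E" and T: "circular emb E T"
    and dom: "monomial_dominates T y x"
  shows "norm x \<le> norm y"
proof -
  have "norm (star x * x) \<le> (norm y)\<^sup>2"
  proof (rule norm_le_of_even_moments[OF faithful])
    fix k
    let ?z = "(star y * y) ^ k"
    have "dominates (E ((star y * y) ^ (2 * k))) (E ((star x * x) ^ (2 * k)))"
      by (intro monomial_dominates_expectation[OF T] monomial_dominates_power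
          monomial_dominates_mult monomial_dominates_star dom)
    then have "norm (E ((star x * x) ^ (2 * k))) \<le> norm (E ((star y * y) ^ (2 * k)))"
      by (rule dominates_norm_le)
    also have "\<dots> = norm (E (?z * ?z))" by (simp add: mult_2 power_add)
    also have "\<dots> \<le> (norm ?z)\<^sup>2"
      by (rule norm_E_square_le) (simp add: star_power star_mult star_star)
    also have "\<dots> \<le> (norm (star y * y) ^ k)\<^sup>2"
      by (intro power_mono norm_power_ineq norm_ge_zero)
    also have "\<dots> = ((norm y)\<^sup>2) ^ (2 * k)"
      by (simp add: cstar_identity mult.commute flip: power_mult)
    finally show "norm (E ((star x * x) ^ (2 * k))) \<le> ((norm y)\<^sup>2) ^ (2 * k)" .
  qed (simp_all add: star_mult star_star)
  then show ?thesis by (simp add: cstar_identity)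
qed

text \<open>
  Every coefficient \<open>b\<close> is dominated by the scalar \<open>norm b + \<delta>\<close>, and scalars can be pulled out of the
  monomial; then \<open>\<delta>\<close> tends to 0.
\<close>
lemma norm_word_le:
  assumes faithful: "faithful_expectation E" and T: "circular emb E T"
  shows "norm (prod_list (map (\<lambda>j. letter T (\<epsilon> j) * emb (b j)) js)) \<le>
    (\<Prod>j\<leftarrow>js. norm (b j)) * norm (prod_list (map (\<lambda>j. letter T (\<epsilon> j)) js))"
proof -
  let ?x = "prod_list (map (\<lambda>j. letter T (\<epsilon> j) * emb (b j)) js)"
  let ?y = "prod_list (map (\<lambda>j. letter T (\<epsilon> j)) js)"
  have bound: "norm ?x \<le> (\<Prod>j\<leftarrow>js. norm (b j) + \<delta>) * norm ?y" if "\<delta> > 0" for \<delta>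
  proof -
    have "monomial_dominates T ((\<Prod>j\<leftarrow>js. norm (b j) + \<delta>) *\<^sub>R ?y) ?x"
    proof (induction js)
      case (Cons j js)
      have "dominates ((norm (b j) + \<delta>) *\<^sub>R 1) (b j)"
        using that by (intro dominates_of_norm_less) simp
      from monomial_dominates_mult[OF monomial_dominates_mult[OF monomial_dominates_letter monomial_emb[OF this]] Cons.IH]
      show ?case by (simp add: scaleR_scaleC emb_scaleC emb_one mult_scaleC_left mult_scaleC_right scaleC_scaleC mult.commute)
    qed (simp add: monomial_dominates_one)
    from monomial_dominates_norm_le[OF faithful T this]
    have "norm ?x \<le> \<bar>\<Prod>j\<leftarrow>js. norm (b j) + \<delta>\<bar> * norm ?y" by simp
    moreover have "0 \<le> (\<Prod>j\<leftarrow>js. norm (b j) + \<delta>)"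
      using that by (intro prod_list_nonneg) (auto intro: add_nonneg_nonneg)
    ultimately show ?thesis by simp
  qed
  have "((\<lambda>\<delta>. norm (b j) + \<delta>) \<longlongrightarrow> norm (b j)) (at_right 0)" for j
    using tendsto_add[OF tendsto_const tendsto_ident_at, of "norm (b j)" 0 "{0<..}"] by simp
  then have "((\<lambda>\<delta>. (\<Prod>j\<leftarrow>js. norm (b j) + \<delta>)) \<longlongrightarrow> (\<Prod>j\<leftarrow>js. norm (b j))) (at_right 0)"
    by (induction js) (simp_all add: tendsto_mult)
  then have "((\<lambda>\<delta>. (\<Prod>j\<leftarrow>js. norm (b j) + \<delta>) * norm ?y) \<longlongrightarrow> (\<Prod>j\<leftarrow>js. norm (b j)) * norm ?y) (at_right 0)"
    by (auto intro!: tendsto_intros)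
  then show ?thesis
    by (rule tendsto_lowerbound) (auto simp: eventually_at_right_less bound intro: eventually_mono[OF eventually_at_right_less])
qed

end

section \<open>Quasinilpotence and the growth of powers\<close>

lemma sum_powers_mult:
  fixes w :: "'a::cstar_algebra"
  shows "(1 - w) * (\<Sum>j<n. w ^ j) = 1 - w ^ n" and "(\<Sum>j<n. w ^ j) * (1 - w) = 1 - w ^ n"
proof -
  have diff: "(1 - w) * w ^ j = w ^ j - w ^ Suc j" "w ^ j * (1 - w) = w ^ j - w ^ Suc j" for j
    by (simp_all add: left_diff_distrib right_diff_distrib power_commutes)
  show "(1 - w) * (\<Sum>j<n. w ^ j) = 1 - w ^ n"
    unfolding sum_distrib_left diff sum_lessThan_telescope' by simp
  show "(\<Sum>j<n. w ^ j) * (1 - w) = 1 - w ^ n"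
    unfolding sum_distrib_right diff sum_lessThan_telescope' by simp
qed

text \<open>
  The noncommutative version of the partial fraction decomposition of \<open>1 / (1 - X ^ n)\<close>: multiplied by
  \<open>1 - t ^ n *\<^sub>R x ^ n\<close>, each resolvent becomes a geometric sum in \<open>l x\<close>, and averaging over the roots
  of unity leaves only its constant term.
\<close>
lemma resolvent_average:
  fixes x :: "'a::cstar_algebra"
  assumes n: "0 < n" and r: "\<And>l. r l * (1 - scaleC l x) = 1"
  shows "((1 / real n) *\<^sub>R (\<Sum>k<n. r (complex_of_real t * cis (2 * pi * real k / real n)))) *
    (1 - t ^ n *\<^sub>R x ^ n) = 1"
proof -
  define l where "l k = complex_of_real t * cis (2 * pi * real k / real n)" for k
  have "l k ^ j = complex_of_real (t ^ j) * cis (2 * pi * real k * of_int (int j) / real n)" for k j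
    by (simp add: l_def power_mult_distrib Complex.DeMoivre mult_ac)
  note l_power = this
  have "l k ^ n = complex_of_real (t ^ n)" for k
    using n cis_multiple_2pi[of "real k"] unfolding l_power by simp
  then have "r (l k) * (1 - t ^ n *\<^sub>R x ^ n) = r (l k) * (1 - scaleC (l k) x ^ n)" for k
    by (simp add: scaleC_power scaleR_scaleC)
  also have "\<dots> k = (\<Sum>j<n. scaleC (l k) x ^ j)" for k
    unfolding sum_powers_mult(1)[symmetric] mult.assoc[symmetric] r by simp
  finally have "(\<Sum>k<n. r (l k)) * (1 - t ^ n *\<^sub>R x ^ n) = (\<Sum>k<n. \<Sum>j<n. scaleC (l k ^ j) (x ^ j))"
    by (simp add: sum_distrib_right scaleC_power)
  also have "\<dots> = (\<Sum>j<n. \<Sum>k<n. scaleC (l k ^ j) (x ^ j))" by (rule sum.swap)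
  also have "\<dots> = (\<Sum>j<n. if j = 0 then real n *\<^sub>R 1 else 0)"
  proof (rule sum.cong[OF refl])
    fix j assume "j \<in> {..<n}"
    then have "int n dvd int j \<longleftrightarrow> j = 0" by (auto dest: dvd_imp_le)
    then show "(\<Sum>k<n. scaleC (l k ^ j) (x ^ j)) = (if j = 0 then real n *\<^sub>R 1 else 0)"
      unfolding scaleC_sum_left[symmetric] l_power sum_distrib_left[symmetric] sum_cis_eq[OF n]
      by (simp add: scaleR_scaleC)
  qed
  also have "\<dots> = real n *\<^sub>R 1" using n by simp
  finally show ?thesis using n by (simp add: l_def)
qed

lemma powers_tendsto_0_of_Bseq:
  fixes x :: "'a::cstar_algebra"
  assumes B: "Bseq (\<lambda>n. t ^ n *\<^sub>R x ^ n)" and s: "0 \<le> s" "s < t"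
  shows "(\<lambda>n. s ^ n *\<^sub>R x ^ n) \<longlonglongrightarrow> 0"
proof -
  from B obtain K where "\<forall>n. norm (t ^ n *\<^sub>R x ^ n) \<le> K" by (rule BseqE)
  then have K: "norm (t ^ n *\<^sub>R x ^ n) \<le> K" for n by (rule spec)
  have bound: "norm (s ^ n *\<^sub>R x ^ n) \<le> (s / t) ^ n * K" for n
  proof -
    have "s ^ n *\<^sub>R x ^ n = (s / t) ^ n *\<^sub>R (t ^ n *\<^sub>R x ^ n)"
      using s by (simp add: power_divide)
    then have "norm (s ^ n *\<^sub>R x ^ n) = (s / t) ^ n * norm (t ^ n *\<^sub>R x ^ n)"
      using s by (simp add: power_divide)
    also have "\<dots> \<le> (s / t) ^ n * K" using s K by (intro mult_left_mono) simp_all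
    finally show ?thesis .
  qed
  have "(\<lambda>n. (s / t) ^ n * K) \<longlonglongrightarrow> 0"
    using s by (intro tendsto_mult_left_zero LIMSEQ_power_zero) simp
  with always_eventually[OF allI, OF bound] show ?thesis by (rule Lim_null_comparison)
qed

lemma invertible_one_minus:
  fixes w :: "'a::cstar_algebra"
  assumes "norm (w ^ n) < 1"
  shows "invertible_elem (1 - w)"
proof -
  define v where "v = w ^ n"
  define g where "g = (\<Sum>k. v ^ k)"
  have "summable (\<lambda>k. v ^ k)" using assms by (intro complete_algebra_summable_geometric) (simp add: v_def)
  then have g: "(\<lambda>k. v ^ k) sums g" unfolding g_def by (rule summable_sums)
  then have g1: "(\<lambda>k. v ^ Suc k) sums (g - 1)" by (subst sums_Suc_iff) simp
  have "v * g = g - 1" using sums_unique2[OF sums_mult[OF g, of v]] g1 by simp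
  moreover have "g * v = g - 1"
    using sums_unique2[OF sums_mult2[OF g, of v]] g1 by (simp add: power_commutes)
  ultimately have gv: "(1 - v) * g = 1" "g * (1 - v) = 1" by (simp_all add: algebra_simps)
  define P where "P = (\<Sum>j<n. w ^ j)"
  have P: "(1 - w) * P = 1 - v" "P * (1 - w) = 1 - v" by (simp_all add: P_def v_def sum_powers_mult)
  have right: "(1 - w) * (P * g) = 1" by (metis gv(1) P(1) mult.assoc)
  have left: "(g * P) * (1 - w) = 1" by (metis gv(2) P(2) mult.assoc)
  have "g * P = g * P * ((1 - w) * (P * g))" by (simp add: right)
  also have "\<dots> = ((g * P) * (1 - w)) * (P * g)" by (simp only: mult.assoc)
  also have "\<dots> = P * g" unfolding left by simp
  finally show ?thesis using left right unfolding invertible_elem_def by metis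
qed

text \<open>
  Rickart's elementary proof of the spectral radius formula, for spectral radius 0.  The resolvent \<open>r\<close> is Lipschitz on the
  disc of radius \<open>R + 1\<close>, hence its averages over roots of unity are Lipschitz on \<open>[0, R + 1]\<close> with
  a constant that does not depend on \<open>n\<close>.  So convergence of \<open>s ^ n *\<^sub>R x ^ n\<close> to 0 can be
  propagated from \<open>s = 0\<close> to \<open>s = R\<close> in steps of a fixed length.
\<close>
lemma powers_tendsto_0:
  fixes x :: "'a::cstar_algebra"
  assumes inv: "\<And>c. c \<noteq> 0 \<Longrightarrow> invertible_elem (scaleC c 1 - x)" and R: "0 \<le> R"
  shows "(\<lambda>n. R ^ n *\<^sub>R x ^ n) \<longlonglongrightarrow> 0"
proof -
  have "\<exists>y. y * (1 - scaleC l x) = 1 \<and> (1 - scaleC l x) * y = 1" for l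
  proof (cases "l = 0")
    case False
    then obtain y where y: "(scaleC (1 / l) 1 - x) * y = 1" "y * (scaleC (1 / l) 1 - x) = 1"
      using inv[of "1 / l"] by (auto simp: invertible_elem_def)
    have "1 - scaleC l x = scaleC l (scaleC (1 / l) 1 - x)"
      using False by (simp add: scaleC_diff_right scaleC_scaleC scaleC_one)
    then show ?thesis using y False
      by (intro exI[of _ "scaleC (1 / l) y"])
        (simp add: mult_scaleC_left mult_scaleC_right scaleC_scaleC scaleC_one)
  qed (auto intro: exI[of _ 1])
  then have "\<forall>l. \<exists>y. y * (1 - scaleC l x) = 1 \<and> (1 - scaleC l x) * y = 1" by (rule allI)
  from choice[OF this] obtain r where "\<forall>l. r l * (1 - scaleC l x) = 1 \<and> (1 - scaleC l x) * r l = 1" ..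
  then have r: "r l * (1 - scaleC l x) = 1" "(1 - scaleC l x) * r l = 1" for l by simp_all
  have resolvent_eq: "r m - r l = scaleC (m - l) (r m * x * r l)" for m l
  proof -
    have "r m - r l = r m * ((1 - scaleC l x) * r l) - (r m * (1 - scaleC m x)) * r l"
      by (simp add: r)
    also have "\<dots> = scaleC (m - l) (r m * x * r l)"
      by (simp add: algebra_simps mult_scaleC_left mult_scaleC_right scaleC_diff_left)
    finally show ?thesis .
  qed
  have norm_diff: "norm (r m - r l) \<le> cmod (m - l) * (norm (r m) * norm x * norm (r l))" for m l
    unfolding resolvent_eq norm_scaleC
    by (intro mult_left_mono norm_mult_ineq[THEN order_trans] mult_right_mono) simp_all
  have "isCont r l" for l
  proof -
    define K where "K = norm x * norm (r l)"
    have K: "0 \<le> K" by (simp add: K_def)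
    have "((\<lambda>m. cmod (m - l) * K) \<longlongrightarrow> cmod (l - l) * K) (at l)" by (intro tendsto_intros)
    then have "((\<lambda>m. cmod (m - l) * K) \<longlongrightarrow> 0) (at l)" by simp
    then have "eventually (\<lambda>m. cmod (m - l) * K < 1 / 2) (at l)" by (rule order_tendstoD) simp
    then have ev: "eventually (\<lambda>m. norm (r m - r l) \<le> cmod (m - l) * (2 * norm (r l) * K)) (at l)"
    proof eventually_elim
      case (elim m)
      have "norm (r m - r l) \<le> (cmod (m - l) * K) * norm (r m)"
        using norm_diff[of m l] by (simp add: K_def mult_ac)
      also have "\<dots> \<le> (1 / 2) * norm (r m)" using elim by (intro mult_right_mono) simp_all
      finally have "norm (r m) \<le> 2 * norm (r l)"
        using norm_triangle_ineq2[of "r m" "r l"] by simp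
      then have "norm (r m) * (cmod (m - l) * K) \<le> 2 * norm (r l) * (cmod (m - l) * K)"
        using K by (intro mult_right_mono) simp_all
      with norm_diff[of m l] show ?case by (simp add: K_def mult_ac)
    qed
    have "((\<lambda>m. cmod (m - l) * (2 * norm (r l) * K)) \<longlongrightarrow> cmod (l - l) * (2 * norm (r l) * K)) (at l)"
      by (intro tendsto_intros)
    then have "((\<lambda>m. cmod (m - l) * (2 * norm (r l) * K)) \<longlongrightarrow> 0) (at l)" by simp
    with ev have "((\<lambda>m. r m - r l) \<longlongrightarrow> 0) (at l)" by (rule Lim_null_comparison)
    then show ?thesis by (simp add: isCont_def LIM_zero_iff)
  qed
  then have "continuous_on (cball 0 (R + 1)) r" by (simp add: continuous_at_imp_continuous_on)
  then have "bounded (r ` cball 0 (R + 1))"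
    by (intro compact_imp_bounded compact_continuous_image) simp_all
  then obtain C where C: "0 < C" "\<And>l. cmod l \<le> R + 1 \<Longrightarrow> norm (r l) \<le> C"
    by (auto simp: bounded_pos)
  define L where "L = C * norm x * C"
  have L: "0 \<le> L" using C by (simp add: L_def)
  have Lipschitz: "norm (r m - r l) \<le> cmod (m - l) * L" if "cmod m \<le> R + 1" "cmod l \<le> R + 1" for m l
    using norm_diff[of m l] C(2)[OF that(1)] C(2)[OF that(2)] C(1) unfolding L_def
    by (elim order_trans) (intro mult_left_mono mult_mono, simp_all)
  define S where "S n t = (1 / real n) *\<^sub>R (\<Sum>k<n. r (complex_of_real t * cis (2 * pi * real k / real n)))" for n t
  have S: "S n t * (1 - t ^ n *\<^sub>R x ^ n) = 1" if "0 < n" for n t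
    unfolding S_def by (rule resolvent_average[OF that r(1)])
  have average: "norm ((1 / real n) *\<^sub>R (\<Sum>k<n. f k)) \<le> B" if "0 < n" "\<And>k. norm (f k) \<le> B" for f :: "nat \<Rightarrow> 'a" and B n
    using that sum_norm_le[of "{..<n}" f "\<lambda>_. B"] by (simp add: field_simps)
  have S_bound: "norm (S n t) \<le> C" if "0 < n" "0 \<le> t" "t \<le> R + 1" for n t
    unfolding S_def using that by (intro average C) (simp_all add: norm_mult)
  have S_Lipschitz: "norm (S n t - S n s) \<le> (t - s) * L"
    if "0 < n" "0 \<le> s" "s \<le> t" "t \<le> R + 1" for n s t
  proof -
    have "norm ((1 / real n) *\<^sub>R (\<Sum>k<n. r (complex_of_real t * cis (2 * pi * real k / real n)) -
        r (complex_of_real s * cis (2 * pi * real k / real n)))) \<le> (t - s) * L"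
    proof (rule average[OF \<open>0 < n\<close>])
      fix k
      let ?w = "cis (2 * pi * real k / real n)"
      have "cmod (complex_of_real t * ?w - complex_of_real s * ?w) = t - s"
        using that by (simp add: norm_mult flip: left_diff_distrib of_real_diff)
      with Lipschitz[of "complex_of_real t * ?w" "complex_of_real s * ?w"] that
      show "norm (r (complex_of_real t * ?w) - r (complex_of_real s * ?w)) \<le> (t - s) * L"
        by (simp add: norm_mult)
    qed
    then show ?thesis by (simp add: S_def sum_subtractf scaleR_diff_right)
  qed
  \<comment> \<open>\<open>S n s\<close> tends to 1 and \<open>S n t\<close> stays within 1/4 of \<open>S n s\<close>, so \<open>1 - t ^ n *\<^sub>R x ^ n\<close>, which
    \<open>S n t\<close> inverts from the left, stays bounded\<close>
  have step: "Bseq (\<lambda>n. t ^ n *\<^sub>R x ^ n)"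
    if Z: "(\<lambda>n. s ^ n *\<^sub>R x ^ n) \<longlonglongrightarrow> 0" and s: "0 \<le> s" "s \<le> t" and t: "t \<le> R + 1" "(t - s) * L \<le> 1 / 4"
    for s t
  proof -
    have "(\<lambda>n. C * norm (s ^ n *\<^sub>R x ^ n)) \<longlonglongrightarrow> 0"
      using tendsto_mult_right_zero[OF tendsto_norm_zero[OF Z], of C] by simp
    then have "eventually (\<lambda>n. C * norm (s ^ n *\<^sub>R x ^ n) < 1 / 4) sequentially"
      by (rule order_tendstoD) simp
    then have "eventually (\<lambda>n. norm (t ^ n *\<^sub>R x ^ n) \<le> norm (3::real)) sequentially"
      using eventually_gt_at_top[of 0]
    proof eventually_elim
      case (elim n)
      define v where "v = s ^ n *\<^sub>R x ^ n"
      define w where "w = t ^ n *\<^sub>R x ^ n"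
      have "S n s - 1 = S n s * v"
        using S[OF elim(2), of s] by (simp add: v_def algebra_simps)
      then have "norm (S n s - 1) \<le> norm (S n s) * norm v" by (simp add: norm_mult_ineq)
      also have "\<dots> \<le> C * norm v" using elim s t by (intro mult_right_mono S_bound) simp_all
      finally have "norm (S n s - 1) \<le> 1 / 4" using elim by (simp add: v_def)
      moreover have "norm (S n t - S n s) \<le> 1 / 4" using S_Lipschitz[of n s t] elim s t by linarith
      ultimately have half: "norm (S n t - 1) \<le> 1 / 2"
        using norm_triangle_ineq[of "S n t - S n s" "S n s - 1"] by simp
      have "1 - w = 1 - (S n t - 1) * (1 - w)"
        using S[OF elim(2), of t] by (simp add: w_def algebra_simps)
      then have "norm (1 - w) \<le> 1 + norm ((S n t - 1) * (1 - w))"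
        by (metis norm_triangle_ineq4 norm_one)
      also have "norm ((S n t - 1) * (1 - w)) \<le> (1 / 2) * norm (1 - w)"
        using half by (intro norm_mult_ineq[THEN order_trans] mult_right_mono) simp_all
      finally have "norm (1 - w) \<le> 2" by simp
      then show ?case using norm_triangle_ineq4[of 1 "1 - w"] by (simp add: w_def)
    qed
    then show ?thesis by (rule Bseq_eventually_mono) simp
  qed
  \<comment> \<open>reach \<open>R\<close> in \<open>m\<close> steps of length \<open>\<eta>\<close>; \<open>step\<close> gives boundedness at distance \<open>2 * \<eta>\<close>, hence
    convergence to 0 at distance \<open>\<eta>\<close>, and only visits radii up to \<open>R + 1\<close>\<close>
  obtain m :: nat where m: "R * (8 * L + 2) < real m" using reals_Archimedean2 by blast
  moreover have "0 \<le> R * (8 * L + 2)" using R L by simp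
  ultimately have m0: "0 < real m" by linarith
  define \<eta> where "\<eta> = R / real m"
  have "\<eta> * (8 * L + 2) \<le> 1" using m m0 by (simp add: \<eta>_def field_simps)
  then have "8 * (\<eta> * L) + 2 * \<eta> \<le> 1" by (simp add: algebra_simps)
  moreover have "0 \<le> \<eta>" "0 \<le> \<eta> * L" using R m0 L by (simp_all add: \<eta>_def)
  ultimately have \<eta>: "0 \<le> \<eta>" "2 * \<eta> * L \<le> 1 / 4" "\<eta> \<le> 1" by linarith+
  have "(\<lambda>n. (real k * \<eta>) ^ n *\<^sub>R x ^ n) \<longlonglongrightarrow> 0" if "k \<le> m" for k
    using that
  proof (induction k)
    case 0
    have "eventually (\<lambda>n. (real 0 * \<eta>) ^ n *\<^sub>R x ^ n = 0) sequentially"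
      using eventually_gt_at_top[of 0] by eventually_elim simp
    then show ?case by (rule tendsto_eventually)
  next
    case (Suc k)
    show ?case
    proof (cases "\<eta> = 0")
      case False
      with \<eta> have "0 < \<eta>" by simp
      have "real (Suc k) * R \<le> real m * R" using Suc.prems R by (intro mult_right_mono) simp_all
      then have "real (Suc k) * \<eta> \<le> R"
        using m0 by (simp add: \<eta>_def pos_divide_le_eq mult.commute del: of_nat_Suc)
      then have "Bseq (\<lambda>n. (real k * \<eta> + 2 * \<eta>) ^ n *\<^sub>R x ^ n)"
        using Suc \<eta> by (intro step[of "real k * \<eta>"]) (auto simp: algebra_simps)
      then show ?thesis
        by (rule powers_tendsto_0_of_Bseq) (use \<open>0 < \<eta>\<close> in \<open>simp_all add: algebra_simps\<close>)
    qed (use Suc in simp)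
  qed
  from this[of m] show ?thesis using m0 by (simp add: \<eta>_def)
qed

text \<open>
  If the powers decay faster than any geometric sequence, some power of \<open>x / c\<close> has norm less than 1
  for each \<open>c \<noteq> 0\<close>, so \<open>c\<close> is not in the spectrum; but 0 is, because an inverse \<open>y\<close> of \<open>x\<close> would
  force \<open>1 \<le> norm y ^ n * norm (x ^ n)\<close> for all \<open>n\<close>.
\<close>
lemma quasinilpotent_iff_powers:
  fixes x :: "'a::cstar_algebra"
  shows "quasinilpotent x \<longleftrightarrow> (\<forall>R\<ge>0. (\<lambda>n. R ^ n *\<^sub>R x ^ n) \<longlonglongrightarrow> 0)"
proof (intro iffI allI impI)
  fix R :: real assume "quasinilpotent x" "0 \<le> R"
  then show "(\<lambda>n. R ^ n *\<^sub>R x ^ n) \<longlonglongrightarrow> 0"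
    by (intro powers_tendsto_0) (auto simp: quasinilpotent_def spectrum_def)
next
  assume lim: "\<forall>R\<ge>0. (\<lambda>n. R ^ n *\<^sub>R x ^ n) \<longlonglongrightarrow> 0"
  have "invertible_elem (scaleC c 1 - x)" if c: "c \<noteq> 0" for c
  proof -
    define w where "w = scaleC (1 / c) x"
    have "(\<lambda>n. (1 / cmod c) ^ n *\<^sub>R x ^ n) \<longlonglongrightarrow> 0" using lim by simp
    then have "eventually (\<lambda>n. norm ((1 / cmod c) ^ n *\<^sub>R x ^ n) < 1) sequentially"
      by (intro order_tendstoD[OF tendsto_norm_zero]) simp_all
    then obtain n where "norm ((1 / cmod c) ^ n *\<^sub>R x ^ n) < 1"
      by (auto simp: eventually_sequentially)
    then have "norm (w ^ n) < 1"
      by (simp add: w_def scaleC_power norm_scaleC norm_power norm_divide)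
    from invertible_one_minus[OF this] obtain y where y: "(1 - w) * y = 1" "y * (1 - w) = 1"
      by (auto simp: invertible_elem_def)
    have "scaleC c 1 - x = scaleC c (1 - w)"
      using c by (simp add: w_def scaleC_diff_right scaleC_scaleC scaleC_one)
    then show ?thesis unfolding invertible_elem_def using y c
      by (intro exI[of _ "scaleC (1 / c) y"])
        (simp add: mult_scaleC_left mult_scaleC_right scaleC_scaleC scaleC_one)
  qed
  moreover have "\<not> invertible_elem (scaleC 0 1 - x)"
  proof
    assume "invertible_elem (scaleC 0 1 - x)"
    then obtain y where "y * (- x) = 1" by (auto simp: invertible_elem_def)
    then have yx: "(- y) * x = 1" by simp
    have "(- y) ^ n * x ^ n = 1" for n
    proof (induction n)
      case (Suc n)
      have "(- y) ^ Suc n * x ^ Suc n = (- y) ^ n * ((- y) * x) * x ^ n"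
        by (simp only: power_Suc2[of "- y"] power_Suc[of x] mult.assoc)
      also have "\<dots> = 1" unfolding yx using Suc by simp
      finally show ?case .
    qed simp
    then have one: "1 \<le> norm (norm y ^ n *\<^sub>R x ^ n)" for n
      using norm_mult_ineq[of "(- y) ^ n" "x ^ n"]
        mult_right_mono[OF norm_power_ineq[of "- y" n] norm_ge_zero[of "x ^ n"]] by simp
    have "(\<lambda>n. norm (norm y ^ n *\<^sub>R x ^ n)) \<longlonglongrightarrow> 0"
      using lim by (intro tendsto_norm_zero) simp
    from LIMSEQ_le_const[OF this, of 1] one show False by auto
  qed
  ultimately show "quasinilpotent x" by (auto simp: quasinilpotent_def spectrum_def)
qed

text \<open>
  The monomial \<open>emb b\<^sub>1 * T * emb b\<^sub>2\<close> is dominated by a scalar multiple of \<open>T\<close>, hence its powers are at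
  most as large as those of that multiple.
\<close>
lemma (in comm_cstar_ncps) quasinilpotent_emb_mult_emb:
  assumes faithful: "faithful_expectation E" and T: "circular emb E T" and q: "quasinilpotent T"
  shows "quasinilpotent (emb b\<^sub>1 * T * emb b\<^sub>2)"
proof -
  define t where "t = (norm b\<^sub>2 + 1) * (norm b\<^sub>1 + 1)"
  have t: "0 \<le> t" by (simp add: t_def)
  let ?z = "emb b\<^sub>1 * T * emb b\<^sub>2"
  have "monomial_dominates T (emb ((norm b\<^sub>1 + 1) *\<^sub>R 1) * letter T Plain * emb ((norm b\<^sub>2 + 1) *\<^sub>R 1)) ?z"
    using monomial_letter[OF dominates_of_norm_less monomial_emb[OF dominates_of_norm_less],
        of b\<^sub>1 "norm b\<^sub>1 + 1" b\<^sub>2 "norm b\<^sub>2 + 1" T Plain] by simp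
  then have dom: "monomial_dominates T (t *\<^sub>R T) ?z"
    by (simp add: t_def scaleR_scaleC emb_scaleC emb_one mult_scaleC_left mult_scaleC_right scaleC_scaleC)
  have "(\<lambda>n. R ^ n *\<^sub>R ?z ^ n) \<longlonglongrightarrow> 0" if R: "0 \<le> R" for R
  proof (rule Lim_null_comparison[OF always_eventually])
    show "\<forall>n. norm (R ^ n *\<^sub>R ?z ^ n) \<le> norm ((R * t) ^ n *\<^sub>R T ^ n)"
    proof
      fix n
      have "norm (?z ^ n) \<le> norm ((t *\<^sub>R T) ^ n)"
        by (intro monomial_dominates_norm_le[OF faithful T] monomial_dominates_power dom)
      then show "norm (R ^ n *\<^sub>R ?z ^ n) \<le> norm ((R * t) ^ n *\<^sub>R T ^ n)"
        using R t by (simp add: scaleR_power power_mult_distrib mult.assoc mult_left_mono)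
    qed
    show "(\<lambda>n. norm ((R * t) ^ n *\<^sub>R T ^ n)) \<longlonglongrightarrow> 0"
      using q R t by (intro tendsto_norm_zero) (simp add: quasinilpotent_iff_powers)
  qed
  then show ?thesis by (simp add: quasinilpotent_iff_powers)
qed

theorem lemma5p3:
  fixes emb :: "'b::comm_cstar_algebra \<Rightarrow> 'a::cstar_algebra"
    and E :: "'a \<Rightarrow> 'b"
    and T :: 'a
  assumes "cstar_ncps emb E"
    and "faithful_expectation E"
    and "circular emb E T"
  shows "(\<forall>(n::nat) (\<epsilon> :: nat \<Rightarrow> exponent) (b :: nat \<Rightarrow> 'b).
      norm (prod_list (map (\<lambda>j. letter T (\<epsilon> j) * emb (b j)) [1..<n+1])) \<le>
        (\<Prod>j=1..n. norm (b j)) * norm (prod_list (map (\<lambda>j. letter T (\<epsilon> j)) [1..<n+1])))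
    \<and> (\<forall>b\<^sub>1 b\<^sub>2 :: 'b. quasinilpotent T \<longrightarrow> quasinilpotent (emb b\<^sub>1 * T * emb b\<^sub>2))"
proof (intro conjI allI impI)
  interpret comm_cstar_ncps emb E using assms(1) by (simp add: comm_cstar_ncps_def)
  show "quasinilpotent (emb b\<^sub>1 * T * emb b\<^sub>2)" if "quasinilpotent T" for b\<^sub>1 b\<^sub>2
    using assms(2,3) that by (rule quasinilpotent_emb_mult_emb)
  fix n :: nat and \<epsilon> :: "nat \<Rightarrow> exponent" and b :: "nat \<Rightarrow> 'b"
  have "(\<Prod>j\<leftarrow>[1..<n+1]. norm (b j)) = (\<Prod>j=1..n. norm (b j))"
    by (subst prod.distinct_set_conv_list[symmetric])
      (simp_all add: atLeastLessThanSuc_atLeastAtMost del: upt_Suc)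
  with norm_word_le[OF assms(2,3), of \<epsilon> b "[1..<n+1]"]
  show "norm (prod_list (map (\<lambda>j. letter T (\<epsilon> j) * emb (b j)) [1..<n+1])) \<le>
        (\<Prod>j=1..n. norm (b j)) * norm (prod_list (map (\<lambda>j. letter T (\<epsilon> j)) [1..<n+1]))"
    by (simp only:)
qed

end
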